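(* Let $V$ be a five-dimensional complex vector space. Let $\mathcal{U}\subset S^3V$ be the set of smooth cubic forms $F\in S^3V$ such that $(J_{F,3})^\perp\subset S^3V^*$ contains a smooth cubic form. Let $F\in\mathcal{U}$ be arbitrary. Then for generic $Q\in S^2V$ (i.e. for all $Q$ in some nonempty Zariski open subset of $S^2V$, which may depend on $F$): (i) the pair $(F,Q)$ is a Fano-K3 pair; (ii) the cubic form $C\in S^3V^*$ associated with $(F,Q)$ is smooth; (iii) $(J_{F,3}:Q)=0$, where $(J_{F,3}:Q)=\{a\in V: aQ\in J_{F,3}\}$.
   Context: $S^\bullet V=\mathrm{Sym}^\bullet V$ is the homogeneous coordinate ring of $\mathbb{P}V^*\cong\mathbb{P}^4$; choosing a basis, it is $\mathbb{C}[x_0,\dots,x_4]$, and $S^\bullet V^*$ is $\mathbb{C}[y_0,\dots,y_4]$ in the dual basis, the homogeneous coordinate ring of $\mathbb{P}V\cong\mathbb{P}^4$. A form $F\in S^3V$ (resp. $G\in S^3V^*$) is called smooth if it is nonzero and the hypersurface $\{F=0\}\subset\mathbb{P}V^*$ (resp. $\{G=0\}\subset\mathbb{P}V$) is smooth. That is, its first partial derivatives have no common zero in projective space; in particular the zero form is not smooth. For $F\in S^3V$, $J_F\subset S^\bullet V$ is the ideal generated by the first partial derivatives of $F$, and $J_{F,k}=J_F\cap S^kV$. The duality pairing $\langle\ ,\ \rangle:S^3V\times S^3V^*\to\mathbb{C}$ is the polar pairing $(F,G)\mapsto G\left(\frac{\partial}{\partial x_0},\dots,\frac{\partial}{\partial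 x_4}\right)F$. For $E\subset S^3V$, $E^\perp=\{a\in S^3V^*:\langle b,a\rangle=0\ \ \forall b\in E\}$. For $F\in S^3V$ smooth and $Q\in S^2V$, set $(J_{F,5}:Q)=\{b\in S^3V: bQ\in J_{F,5}\}$. Since $F$ is smooth, $\dim S^5V/J_{F,5}=1$, so $(J_{F,5}:Q)^\perp$ has dimension at most one. The cubic form $C\in S^3V^*$ associated with $(F,Q)$ is characterized, up to a nonzero scalar, by $\mathbb{C}C=(J_{F,5}:Q)^\perp$. The pair $(F,Q)$ with $F\in S^3V$, $Q\in S^2V$ is a Fano-K3 pair if the cubic threefold $X=\{F=0\}\subset\mathbb{P}V^*$ is smooth and its anticanonical section $Y=\{F=Q=0\}\subset X$ is a smooth surface. The latter means that the gradients of $F$ and $Q$ are linearly independent at every common zero of $F$ and $Q$ in $\mathbb{P}V^*$. *)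

theory Defs
  imports "HOL-Analysis.Analysis" "HOL-Library.Poly_Mapping"
begin

text \<open>
  After the choice of a basis of \<open>V\<close>, an element of \<open>Sym V\<close> is a polynomial in \<open>x\<^sub>0, \<dots>, x\<^sub>4\<close>, and an
  element of \<open>Sym V\<^sup>*\<close> is a polynomial in the dual variables \<open>y\<^sub>0, \<dots>, y\<^sub>4\<close>. Both are represented by
  the type \<open>poly5\<close>: exponent vectors indexed by the five-element type \<open>5\<close> (elements 0 to 4),
  mapped to coefficients. Points of the projective spaces are nonzero vectors of \<open>complex ^ 5\<close>.
\<close>

type_synonym ('v, 'a) mvpoly = "('v \<Rightarrow>\<^sub>0 nat) \<Rightarrow>\<^sub>0 'a"

type_synonym poly5 = "(5, complex) mvpoly"

definition mv_const :: "'a \<Rightarrow> ('v, 'a::zero) mvpoly" where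
  "mv_const c = Poly_Mapping.single 0 c"

definition mv_eval :: "('v, 'a::comm_semiring_1) mvpoly \<Rightarrow> ('v \<Rightarrow> 'a) \<Rightarrow> 'a" where
  "mv_eval p f =
    (\<Sum>m\<in>Poly_Mapping.keys p. Poly_Mapping.lookup p m *
      (\<Prod>v\<in>Poly_Mapping.keys m. f v ^ Poly_Mapping.lookup m v))"

text \<open>Subtraction of exponents is truncated, but if \<open>i\<close> does not occur in \<open>m\<close>, the coefficient
  vanishes.\<close>

definition mv_pderiv :: "'v \<Rightarrow> ('v, 'a::comm_semiring_1) mvpoly \<Rightarrow> ('v, 'a) mvpoly" where
  "mv_pderiv i p =
    (\<Sum>m\<in>Poly_Mapping.keys p.
      Poly_Mapping.single (m - Poly_Mapping.single i 1)
        (of_nat (Poly_Mapping.lookup m i) * Poly_Mapping.lookup p m))"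

text \<open>The space of forms of degree \<open>d\<close>, including the zero form.\<close>

definition forms :: "nat \<Rightarrow> poly5 set" where
  "forms d = {p. \<forall>m\<in>Poly_Mapping.keys p. (\<Sum>i\<in>UNIV. Poly_Mapping.lookup m i) = d}"

definition gradient :: "poly5 \<Rightarrow> complex ^ 5 \<Rightarrow> complex ^ 5" where
  "gradient p v = (\<chi> i. mv_eval (mv_pderiv i p) (($) v))"

definition smooth_form :: "poly5 \<Rightarrow> bool" where
  "smooth_form F \<longleftrightarrow> F \<noteq> 0 \<and> (\<forall>v. v \<noteq> 0 \<longrightarrow> gradient F v \<noteq> 0)"

text \<open>Ideals are the submodules of the ring over itself, so \<open>ideal.span S\<close> is the ideal generated
  by \<open>S\<close>.\<close>

global_interpretation ideal: module "(*) :: poly5 \<Rightarrow> poly5 \<Rightarrow> poly5"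
  by unfold_locales (simp_all add: algebra_simps)

definition jacobian_ideal :: "poly5 \<Rightarrow> poly5 set" where
  "jacobian_ideal F = ideal.span (range (\<lambda>i. mv_pderiv i F))"

definition jacobian_part :: "poly5 \<Rightarrow> nat \<Rightarrow> poly5 set" where
  "jacobian_part F k = jacobian_ideal F \<inter> forms k"

text \<open>For a quadratic form \<open>Q\<close>, \<open>colon_part F k Q\<close> is \<open>(J\<^bsub>F,k+2\<^esub> : Q)\<close>; the index \<open>k\<close> is the degree of
  its elements.\<close>

definition colon_part :: "poly5 \<Rightarrow> nat \<Rightarrow> poly5 \<Rightarrow> poly5 set" where
  "colon_part F k Q = {b \<in> forms k. b * Q \<in> jacobian_part F (k + 2)}"

definition diff_monom :: "(5 \<Rightarrow>\<^sub>0 nat) \<Rightarrow> poly5 \<Rightarrow> poly5" where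
  "diff_monom m =
    (mv_pderiv 0 ^^ Poly_Mapping.lookup m 0) \<circ> (mv_pderiv 1 ^^ Poly_Mapping.lookup m 1) \<circ>
    (mv_pderiv 2 ^^ Poly_Mapping.lookup m 2) \<circ> (mv_pderiv 3 ^^ Poly_Mapping.lookup m 3) \<circ>
    (mv_pderiv 4 ^^ Poly_Mapping.lookup m 4)"

text \<open>The operator \<open>G(\<partial>/\<partial>x\<^sub>0, \<dots>, \<partial>/\<partial>x\<^sub>4)\<close> applied to \<open>F\<close>.\<close>

definition diff_op :: "poly5 \<Rightarrow> poly5 \<Rightarrow> poly5" where
  "diff_op G F =
    (\<Sum>m\<in>Poly_Mapping.keys G. mv_const (Poly_Mapping.lookup G m) * diff_monom m F)"

text \<open>For \<open>F\<close> and \<open>G\<close> of the same degree, \<open>diff_op G F\<close> is a constant polynomial, and the pairing is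
  its constant coefficient.\<close>

definition polar_pairing :: "poly5 \<Rightarrow> poly5 \<Rightarrow> complex" where
  "polar_pairing F G = Poly_Mapping.lookup (diff_op G F) 0"

definition cubic_perp :: "poly5 set \<Rightarrow> poly5 set" where
  "cubic_perp E = {a \<in> forms 3. \<forall>b\<in>E. polar_pairing b a = 0}"

text \<open>The line (or zero space) spanned by \<open>C\<close> is \<open>(J\<^bsub>F,5\<^esub> : Q)\<^sup>\<bottom>\<close>.\<close>

definition associated_cubic :: "poly5 \<Rightarrow> poly5 \<Rightarrow> poly5 \<Rightarrow> bool" where
  "associated_cubic F Q C \<longleftrightarrow>
    range (\<lambda>c. mv_const c * C) = cubic_perp (colon_part F 3 Q)"

text \<open>Linear independence of the two gradients is spelled out for the pair, since independence of
  the set containing them would miss the case where they coincide.\<close>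

definition fano_K3_pair :: "poly5 \<Rightarrow> poly5 \<Rightarrow> bool" where
  "fano_K3_pair F Q \<longleftrightarrow>
    F \<in> forms 3 \<and> Q \<in> forms 2 \<and> smooth_form F \<and>
    (\<forall>v. v \<noteq> 0 \<and> mv_eval F (($) v) = 0 \<and> mv_eval Q (($) v) = 0 \<longrightarrow>
      (\<forall>a b. a *s gradient F v + b *s gradient Q v = 0 \<longrightarrow> a = 0 \<and> b = 0))"

text \<open>Polynomial functions on the space of forms of degree \<open>d\<close> are polynomials in the coefficients
  of a form, so their variables are indexed by exponent vectors; the coefficients in other degrees
  are zero. A Zariski open set is the complement of the zero locus of a set \<open>P\<close> of such polynomials.\<close>

definition zariski_open_forms :: "nat \<Rightarrow> poly5 set \<Rightarrow> bool" where
  "zariski_open_forms d U \<longleftrightarrow>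
    (\<exists>P :: (5 \<Rightarrow>\<^sub>0 nat, complex) mvpoly set.
      U = {Q \<in> forms d. \<exists>p\<in>P. mv_eval p (Poly_Mapping.lookup Q) \<noteq> 0})"

definition generic_form :: "nat \<Rightarrow> (poly5 \<Rightarrow> bool) \<Rightarrow> bool" where
  "generic_form d R \<longleftrightarrow> (\<exists>U. zariski_open_forms d U \<and> U \<noteq> {} \<and> (\<forall>Q\<in>U. R Q))"

definition smooth_perp_cubics :: "poly5 set" where
  "smooth_perp_cubics =
    {F \<in> forms 3. smooth_form F \<and> (\<exists>G \<in> cubic_perp (jacobian_part F 3). smooth_form G)}"

end

theory Submission
  imports Defs "HOL-Computational_Algebra.Fundamental_Theorem_Algebra"
begin

text \<open>
  The quotient of the polynomial ring by the Jacobian ideal of a smooth cubic is Gorenstein with socle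
  in degree 5. To see this, replace the five quadrics one by one with coordinates, after generic linear
  changes which keep the intermediate systems free of common zeros; the Nullstellensatz puts a power
  of each coordinate into the next ideal, and regularity and the socle are carried along each exchange.

  A functional \<open>lam\<close> on quintic forms with kernel \<open>J\<^bsub>F,5\<^esub>\<close> turns every quadric \<open>Q\<close> into the cubic
  \<open>C\<^sub>Q\<close> representing \<open>b \<mapsto> lam (b Q)\<close>. It spans \<open>(J\<^bsub>F,5\<^esub> : Q)\<^sup>\<bottom>\<close>, depends linearly on \<open>Q\<close>, and by the perfect
  pairing every cubic in \<open>(J\<^bsub>F,3\<^esub>)\<^sup>\<bottom>\<close> is some \<open>C\<^sub>Q\<close>. So some \<open>C\<^sub>Q\<close> is smooth, and smoothness is an open
  condition. If \<open>C\<^sub>Q\<close> is smooth and \<open>a Q \<in> J\<^bsub>F,3\<^esub>\<close> for a linear form \<open>a\<close>, then \<open>C\<^sub>Q\<close> is polar to all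
  \<open>a q\<close>, hence singular at the point \<open>a\<close> unless \<open>a = 0\<close>. The Fano-K3 condition is open as well, and a
  diagonal quadric with coefficients outside a set of measure zero satisfies it.
\<close>

text \<open>No Hilbert function and no dimension of a graded piece is computed. A single existence
  statement, that every class outside the ideal has a multiple equal to the socle generator
  \<open>s\<close>, yields what is needed: for a quintic the cofactor is a nonzero constant, so the
  quintics modulo the ideal form a line; for a cubic it gives one side of the perfect pairing, which
  linear algebra turns into surjectivity onto the orthogonal complement. The socle degree 5 is a
  count: the coordinates have socle degree 0, and trading a linear form for a quadric raises it by 2
  - 1. The generic changes are forced, since some of the quadrics together with some of the
  coordinates may have a common zero although the five quadrics have none. Measure zero arguments
  take the place of dimension theory and of Bertini's theorem: differentiable images of negligible
  sets in the same space are negligible, so there are points that avoid them.\<close>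

subsection \<open>Evaluation and derivatives\<close>

text \<open>As a simplification rule, this loops with \<open>mult.assoc\<close>.\<close>

declare ideal.scale_scale [simp del]

abbreviation lookup :: "('a \<Rightarrow>\<^sub>0 'b::zero) \<Rightarrow> 'a \<Rightarrow> 'b" where "lookup \<equiv> Poly_Mapping.lookup"
abbreviation keys :: "('a \<Rightarrow>\<^sub>0 'b::zero) \<Rightarrow> 'a set" where "keys \<equiv> Poly_Mapping.keys"
abbreviation single :: "'a \<Rightarrow> 'b \<Rightarrow> 'a \<Rightarrow>\<^sub>0 'b::zero" where "single \<equiv> Poly_Mapping.single"

lemma sum_single_lookup: "(\<Sum>m\<in>keys p. single m (lookup p m)) = p"
  by (rule poly_mapping_eqI) (simp add: lookup_sum lookup_single when_def in_keys_iff)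

lemma mv_induct [case_names single add]:
  fixes p :: "('v, 'a::comm_monoid_add) mvpoly"
  assumes "\<And>m c. P (single m c)" and "\<And>p q. P p \<Longrightarrow> P q \<Longrightarrow> P (p + q)"
  shows "P p"
proof -
  have "P (\<Sum>m\<in>M. single m (lookup p m))" if "finite M" for M
    using that by (induction M rule: finite_induct) (use assms assms(1)[of _ 0] in auto)
  from this[of "keys p"] show ?thesis by (simp add: sum_single_lookup)
qed

lemma lookup_single_mult:
  fixes p :: "('v, 'a::comm_semiring_1) mvpoly"
  shows "lookup (single n c * p) (n + m) = c * lookup p m"
proof (induction p rule: mv_induct)
  case (single k d)
  then show ?case by (auto simp: mult_single lookup_single when_def)
next
  case (add p q)
  then show ?case by (simp add: algebra_simps lookup_add)
qed

lemma lookup_single_mult_eq_0: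
  fixes p :: "('v, 'a::comm_semiring_1) mvpoly"
  assumes "\<And>k. m \<noteq> n + k"
  shows "lookup (single n c * p) m = 0"
proof (induction p rule: mv_induct)
  case (single k d)
  then show ?case using assms[of k] by (auto simp: mult_single lookup_single when_def)
next
  case (add p q)
  then show ?case by (simp add: algebra_simps lookup_add)
qed

lemma lookup_mv_const_mult [simp]:
  fixes p :: "('v, 'a::comm_semiring_1) mvpoly"
  shows "lookup (mv_const c * p) m = c * lookup p m"
  using lookup_single_mult[of 0 c p m] by (simp add: mv_const_def)

lemma mv_const_simps [simp]:
  "mv_const (0 :: 'a::comm_ring_1) = 0" "mv_const (1 :: 'a::comm_ring_1) = 1"
  "mv_const (a + b :: 'a::comm_ring_1) = mv_const a + mv_const b"
  "mv_const (a * b :: 'a::comm_ring_1) = mv_const a * mv_const b"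
  "mv_const (a - b :: 'a::comm_ring_1) = mv_const a - mv_const b"
  "mv_const (- a :: 'a::comm_ring_1) = - mv_const a"
  by (simp_all add: mv_const_def single_add mult_single single_diff single_uminus)

definition mon_eval :: "('v \<Rightarrow> 'a::comm_semiring_1) \<Rightarrow> ('v \<Rightarrow>\<^sub>0 nat) \<Rightarrow> 'a" where
  "mon_eval f m = (\<Prod>v\<in>keys m. f v ^ lookup m v)"

lemma mon_eval_superset:
  assumes "finite S" "keys m \<subseteq> S"
  shows "mon_eval f m = (\<Prod>v\<in>S. f v ^ lookup m v)"
  unfolding mon_eval_def
  by (rule prod.mono_neutral_left) (use assms in \<open>auto simp: in_keys_iff\<close>)

lemma mon_eval_UNIV: "mon_eval f m = (\<Prod>v\<in>UNIV. f v ^ lookup m (v :: 'v :: finite))"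
  by (rule mon_eval_superset) auto

lemma mon_eval_0 [simp]: "mon_eval f 0 = 1"
  by (simp add: mon_eval_def)

lemma mon_eval_add: "mon_eval f (m + n) = mon_eval f m * mon_eval f n"
proof -
  let ?S = "keys m \<union> keys n"
  have "keys (m + n) \<subseteq> ?S" by (rule Poly_Mapping.keys_add)
  then show ?thesis
    by (simp add: mon_eval_superset[of ?S] lookup_add power_add prod.distrib)
qed

lemma mon_eval_single [simp]: "mon_eval f (single i k) = f i ^ k"
  by (subst mon_eval_superset[of "{i}"]) auto

lemma mv_eval_superset:
  assumes "finite S" "keys p \<subseteq> S"
  shows "mv_eval p f = (\<Sum>m\<in>S. lookup p m * mon_eval f m)"
  unfolding mv_eval_def mon_eval_def
  by (rule sum.mono_neutral_left) (use assms in \<open>auto simp: in_keys_iff\<close>)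

lemma mv_eval_single [simp]: "mv_eval (single m c) f = c * mon_eval f m"
  by (subst mv_eval_superset[of "{m}"]) auto

lemma mv_eval_add [simp]: "mv_eval (p + q) f = mv_eval p f + mv_eval q f"
proof -
  let ?S = "keys p \<union> keys q"
  have "keys (p + q) \<subseteq> ?S" by (rule Poly_Mapping.keys_add)
  then show ?thesis
    by (simp add: mv_eval_superset[of ?S] lookup_add algebra_simps sum.distrib)
qed

lemma mv_eval_mult [simp]: "mv_eval (p * q) f = mv_eval p f * mv_eval q f"
proof (induction p rule: mv_induct)
  case (single m c)
  show ?case
    by (induction q rule: mv_induct) (simp_all add: mult_single mon_eval_add algebra_simps)
qed (simp add: algebra_simps)

lemma mv_eval_simps [simp]:
  "mv_eval 0 f = 0" "mv_eval 1 f = 1" "mv_eval (mv_const c) f = c"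
  by (simp add: mv_eval_def) (use mv_eval_single[of 0 1 f] in \<open>simp_all add: mv_const_def\<close>)

lemma mv_eval_sum [simp]: "mv_eval (sum g S) f = (\<Sum>x\<in>S. mv_eval (g x) f)"
  by (induction S rule: infinite_finite_induct) auto

lemma mv_eval_uminus [simp]: "mv_eval (- p) f = - mv_eval (p :: ('v, 'a::comm_ring_1) mvpoly) f"
proof -
  have "mv_eval (- p) f + mv_eval p f = mv_eval (- p + p) f" by (simp only: mv_eval_add)
  then show ?thesis by (simp add: eq_neg_iff_add_eq_0)
qed

lemma mv_eval_diff [simp]:
  "mv_eval (p - q) f = mv_eval p f - mv_eval (q :: ('v, 'a::comm_ring_1) mvpoly) f"
  using mv_eval_add[of p "- q"] by simp

definition var :: "'v \<Rightarrow> ('v, 'a::comm_semiring_1) mvpoly" where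
  "var i = single (single i 1) 1"

lemma mv_eval_var [simp]: "mv_eval (var i) f = f i"
  by (simp add: var_def)

lemma var_power: "var i ^ n = single (single i n) 1"
  by (induction n) (simp_all add: var_def mult_single flip: single_add)

lemma single_eq_const_mult: "single m c = mv_const c * single m (1::'a::comm_semiring_1)"
  by (simp add: mv_const_def mult_single)

lemma exponent_split:
  fixes m :: "'v \<Rightarrow>\<^sub>0 nat"
  assumes "n \<le> lookup m i"
  shows "m = single i n + (m - single i n)"
proof (rule poly_mapping_eqI)
  show "lookup m k = lookup (single i n + (m - single i n)) k" for k
    using assms by (cases "i = k") (simp_all add: lookup_add lookup_minus lookup_single)
qed

lemma lookup_mv_pderiv:
  fixes p :: "('v, 'a::comm_semiring_1) mvpoly"
  shows "lookup (mv_pderiv i p) m = of_nat (lookup m i + 1) * lookup p (m + single i 1)"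
proof -
  let ?k = "m + single i 1"
  have "lookup (mv_pderiv i p) m =
      (\<Sum>k\<in>keys p. of_nat (lookup k i) * lookup p k when k - single i 1 = m)"
    by (simp add: mv_pderiv_def lookup_sum lookup_single)
  also have "\<dots> = (\<Sum>k\<in>keys p. of_nat (lookup k i) * lookup p k when k = ?k)"
  proof (rule sum.cong)
    fix k
    show "(of_nat (lookup k i) * lookup p k when k - single i 1 = m)
        = (of_nat (lookup k i) * lookup p k when k = ?k)"
    \<comment> \<open>If \<open>i\<close> does not occur in \<open>k\<close>, truncation may give
      \<open>k - single i 1 = m\<close> although \<open>k\<close> differs from \<open>?k\<close>;
      the coefficient is zero in that case.\<close>
    proof (cases "lookup k i = 0")
      case False
      then have "k = single i 1 + (k - single i 1)" by (intro exponent_split) simp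
      then have "k - single i 1 = m \<longleftrightarrow> k = ?k"
        by (metis add.commute add_diff_cancel_right')
      then show ?thesis by simp
    qed (auto simp: when_def)
  qed simp
  also have "\<dots> = of_nat (lookup ?k i) * lookup p ?k"
    by (auto simp: when_def in_keys_iff)
  finally show ?thesis by (simp add: lookup_add)
qed

lemma mv_pderiv_add: "mv_pderiv i (p + q) = mv_pderiv i p + mv_pderiv i q"
  by (rule poly_mapping_eqI) (simp add: lookup_mv_pderiv lookup_add algebra_simps)

lemma mv_pderiv_const_mult: "mv_pderiv i (mv_const c * p) = mv_const c * mv_pderiv i p"
  by (rule poly_mapping_eqI) (simp add: lookup_mv_pderiv mult.left_commute)

lemma mv_eval_mv_pderiv:
  "mv_eval (mv_pderiv i p) f =
    (\<Sum>m\<in>keys p. of_nat (lookup m i) * lookup p m * mon_eval f (m - single i 1))"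
  by (simp add: mv_pderiv_def)

text \<open>The bridge from formal to analytic derivatives: a polynomial that is constant along a
  coordinate line has vanishing formal derivative there.\<close>

lemma mv_pderiv_has_derivative:
  fixes p :: "('v::finite, complex) mvpoly"
  shows "((\<lambda>s. mv_eval p (f(i := s))) has_field_derivative
    mv_eval (mv_pderiv i p) (f(i := s))) (at s)"
proof -
  have mon: "mon_eval (f(i := s)) m = s ^ lookup m i * (\<Prod>v\<in>UNIV-{i}. f v ^ lookup m v)" for m s
    by (subst mon_eval_UNIV, subst prod.remove[of _ i]) (auto intro!: prod.cong)
  have eq: "mv_eval p (f(i := s)) =
      (\<Sum>m\<in>keys p. lookup p m * (s ^ lookup m i * (\<Prod>v\<in>UNIV-{i}. f v ^ lookup m v)))" for s
    by (simp add: mv_eval_superset[of "keys p"] mon)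
  have pr: "(\<Prod>v\<in>UNIV-{i}. f v ^ (lookup m v - lookup (single i (Suc 0)) v))
      = (\<Prod>v\<in>UNIV-{i}. f v ^ lookup m v)" for m
    by (rule prod.cong) (auto simp: lookup_single)
  let ?C = "\<lambda>m. \<Prod>v\<in>UNIV-{i}. f v ^ lookup m v"
  have "((\<lambda>s. \<Sum>m\<in>keys p. lookup p m * (s ^ lookup m i * ?C m)) has_field_derivative
      (\<Sum>m\<in>keys p. lookup p m * (of_nat (lookup m i) * s ^ (lookup m i - 1) * ?C m))) (at s)"
    by (rule DERIV_sum) (auto intro!: derivative_eq_intros)
  also have "(\<Sum>m\<in>keys p. lookup p m * (of_nat (lookup m i) * s ^ (lookup m i - 1) * ?C m))
      = mv_eval (mv_pderiv i p) (f(i := s))"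
    unfolding mv_eval_mv_pderiv mon by (rule sum.cong) (simp_all add: lookup_minus pr)
  finally show ?thesis
    unfolding eq .
qed

subsection \<open>Forms\<close>

definition edeg :: "('v::finite \<Rightarrow>\<^sub>0 nat) \<Rightarrow> nat" where
  "edeg m = (\<Sum>i\<in>UNIV. lookup m i)"

lemma edeg_add [simp]: "edeg (m + n) = edeg m + edeg n"
  by (simp add: edeg_def lookup_add sum.distrib)

lemma edeg_single [simp]: "edeg (single i n) = n"
  by (simp add: edeg_def lookup_single when_def)

lemma edeg_eq_0 [simp]: "edeg m = 0 \<longleftrightarrow> m = 0"
  by (auto simp: edeg_def intro: poly_mapping_eqI)

lemma edeg_0 [simp]: "edeg 0 = 0"
  by simp

lemma finite_edeg_le: "finite {m :: 'v::finite \<Rightarrow>\<^sub>0 nat. edeg m \<le> d}"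
proof -
  have "lookup m i \<le> d" if "edeg m \<le> d" for m :: "'v \<Rightarrow>\<^sub>0 nat" and i
    using member_le_sum[of i UNIV "lookup m"] that by (simp add: edeg_def)
  then have "lookup ` {m :: 'v \<Rightarrow>\<^sub>0 nat. edeg m \<le> d} \<subseteq> PiE UNIV (\<lambda>_. {..d})"
    by auto
  then have "finite (lookup ` {m :: 'v \<Rightarrow>\<^sub>0 nat. edeg m \<le> d})"
    by (rule finite_subset) (auto intro: finite_PiE)
  then show ?thesis
    by (rule finite_imageD) (auto intro: inj_onI simp: lookup_inject)
qed

lemma finite_edeg_eq: "finite {m :: 'v::finite \<Rightarrow>\<^sub>0 nat. edeg m = d}"
  by (rule finite_subset[OF _ finite_edeg_le[of d]]) auto

lemma forms_iff: "p \<in> forms d \<longleftrightarrow> (\<forall>m. lookup p m \<noteq> 0 \<longrightarrow> edeg m = d)"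
  by (auto simp: forms_def edeg_def in_keys_iff)

lemma forms_0 [simp]: "0 \<in> forms d"
  by (simp add: forms_iff)

lemma forms_add: "p \<in> forms d \<Longrightarrow> q \<in> forms d \<Longrightarrow> p + q \<in> forms d"
  by (auto simp: forms_iff lookup_add) (metis add_0)

lemma forms_uminus: "p \<in> forms d \<Longrightarrow> - p \<in> forms d"
  by (auto simp: forms_iff)

lemma forms_diff: "p \<in> forms d \<Longrightarrow> q \<in> forms d \<Longrightarrow> p - q \<in> forms d"
  using forms_add[of p d "- q"] forms_uminus[of q d] by simp

lemma forms_sum: "(\<And>x. x \<in> S \<Longrightarrow> g x \<in> forms d) \<Longrightarrow> sum g S \<in> forms d"
  by (induction S rule: infinite_finite_induct) (auto intro: forms_add)

lemma forms_const_mult: "p \<in> forms d \<Longrightarrow> mv_const c * p \<in> forms d"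
  by (auto simp: forms_iff)

lemma forms_single: "edeg m = d \<Longrightarrow> single m c \<in> forms d"
  by (auto simp: forms_iff lookup_single when_def split: if_splits)

lemma forms_var: "var i \<in> forms 1"
  unfolding var_def by (rule forms_single) simp

lemma mv_const_forms: "mv_const c \<in> forms 0"
  unfolding mv_const_def by (rule forms_single) simp

lemma forms_single_mult:
  assumes "q \<in> forms e"
  shows "single m c * q \<in> forms (edeg m + e)"
proof -
  have "edeg k = edeg m + e" if "lookup (single m c * q) k \<noteq> 0" for k
  proof -
    obtain l where l: "k = m + l"
      using \<open>lookup (single m c * q) k \<noteq> 0\<close> lookup_single_mult_eq_0 by blast
    with that assms show ?thesis by (simp add: lookup_single_mult forms_iff)
  qed
  then show ?thesis by (auto simp: forms_iff)
qed

lemma forms_mult: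
  assumes "p \<in> forms d" "q \<in> forms e"
  shows "p * q \<in> forms (d + e)"
proof -
  have "p * q = (\<Sum>m\<in>keys p. single m (lookup p m) * q)"
    by (simp add: sum_single_lookup flip: sum_distrib_right)
  also have "\<dots> \<in> forms (d + e)"
    by (intro forms_sum) (use assms forms_single_mult in \<open>auto simp: forms_iff in_keys_iff\<close>)
  finally show ?thesis .
qed

lemma forms_power: "p \<in> forms d \<Longrightarrow> p ^ n \<in> forms (n * d)"
  by (induction n) (auto intro: forms_mult mv_const_forms[of 1, simplified])

lemma forms_mv_pderiv: "p \<in> forms (Suc d) \<Longrightarrow> mv_pderiv i p \<in> forms d"
  by (auto simp: forms_iff lookup_mv_pderiv)

lemma euler_identity:
  assumes "p \<in> forms d"
  shows "(\<Sum>i\<in>UNIV. f i * mv_eval (mv_pderiv i p) f) = of_nat d * mv_eval p f"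
proof -
  have mon: "f i * (of_nat (lookup m i) * c * mon_eval f (m - single i 1))
      = of_nat (lookup m i) * (c * mon_eval f m)" for i m c
  proof (cases "lookup m i = 0")
    case False
    then have "m = single i 1 + (m - single i 1)" by (intro exponent_split) simp
    then have "mon_eval f m = f i * mon_eval f (m - single i 1)"
      by (metis mon_eval_add mon_eval_single power_one_right)
    then show ?thesis by simp
  qed simp
  have "(\<Sum>i\<in>UNIV. f i * mv_eval (mv_pderiv i p) f)
      = (\<Sum>m\<in>keys p. \<Sum>i\<in>UNIV. of_nat (lookup m i) * (lookup p m * mon_eval f m))"
    unfolding mv_eval_mv_pderiv sum_distrib_left mon by (rule sum.swap)
  also have "\<dots> = (\<Sum>m\<in>keys p. of_nat (edeg m) * (lookup p m * mon_eval f m))"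
    by (simp add: edeg_def sum_distrib_right)
  also have "\<dots> = of_nat d * (\<Sum>m\<in>keys p. lookup p m * mon_eval f m)"
    unfolding sum_distrib_left
    by (rule sum.cong) (use assms in \<open>auto simp: forms_iff in_keys_iff\<close>)
  finally show ?thesis by (simp add: mv_eval_superset[of "keys p"])
qed

lemma mon_eval_scale: "mon_eval (\<lambda>i. s * f i) (m :: 'v::finite \<Rightarrow>\<^sub>0 nat) = s ^ edeg m * mon_eval f m"
  by (simp add: mon_eval_UNIV power_mult_distrib prod.distrib edeg_def power_sum)

lemma mv_eval_forms_scale:
  assumes "p \<in> forms d"
  shows "mv_eval p (\<lambda>i. s * f i) = s ^ d * mv_eval p f"
proof -
  have "mv_eval p (\<lambda>i. s * f i) = (\<Sum>m\<in>keys p. lookup p m * (s ^ edeg m * mon_eval f m))"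
    by (simp add: mv_eval_superset[of "keys p"] mon_eval_scale)
  also have "\<dots> = (\<Sum>m\<in>keys p. s ^ d * (lookup p m * mon_eval f m))"
    by (rule sum.cong) (use assms in \<open>auto simp: forms_iff in_keys_iff\<close>)
  finally show ?thesis by (simp add: mv_eval_superset[of "keys p" p f] sum_distrib_left)
qed

section \<open>Homogeneous components\<close>

definition hcomp :: "nat \<Rightarrow> poly5 \<Rightarrow> poly5" where
  "hcomp d p = (\<Sum>m | m \<in> keys p \<and> edeg m = d. single m (lookup p m))"

lemma lookup_hcomp: "lookup (hcomp d p) m = (if edeg m = d then lookup p m else 0)"
  by (simp add: hcomp_def lookup_sum lookup_single when_def in_keys_iff)

lemma hcomp_forms: "hcomp d p \<in> forms d"
  by (simp add: forms_iff lookup_hcomp)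

lemma hcomp_of_forms: "p \<in> forms e \<Longrightarrow> hcomp d p = (if d = e then p else 0)"
  by (rule poly_mapping_eqI) (auto simp: lookup_hcomp forms_iff)

lemma hcomp_add: "hcomp d (p + q) = hcomp d p + hcomp d q"
  by (rule poly_mapping_eqI) (simp add: lookup_hcomp lookup_add)

lemma hcomp_0 [simp]: "hcomp d 0 = 0"
  by (rule poly_mapping_eqI) (simp add: lookup_hcomp)

lemma hcomp_diff: "hcomp d (p - q) = hcomp d p - hcomp d q"
  by (rule poly_mapping_eqI) (simp add: lookup_hcomp lookup_minus)

lemma hcomp_const_mult: "hcomp d (mv_const c * q) = mv_const c * hcomp d q"
  by (rule poly_mapping_eqI) (simp add: lookup_hcomp)

lemma hcomp_mult_forms:
  assumes "q \<in> forms e"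
  shows "hcomp d (p * q) = (if e \<le> d then hcomp (d - e) p * q else 0)"
proof (induction p rule: mv_induct)
  case (single m c)
  have "hcomp d (single m c * q) = (if d = edeg m + e then single m c * q else 0)"
    by (rule hcomp_of_forms) (rule forms_single_mult[OF assms])
  moreover have "hcomp (d - e) (single m c) = (if d - e = edeg m then single m c else 0)"
    by (rule hcomp_of_forms) (rule forms_single, simp)
  ultimately show ?case by auto
next
  case (add p q)
  then show ?case by (cases "e \<le> d") (simp_all add: hcomp_add distrib_right)
qed

lemma sum_hcomp:
  assumes "\<And>m. m \<in> keys p \<Longrightarrow> edeg m \<le> n"
  shows "(\<Sum>d\<le>n. hcomp d p) = p"
  by (rule poly_mapping_eqI) (use assms in \<open>auto simp: lookup_sum lookup_hcomp in_keys_iff\<close>)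

lemma degree_bound_exists:
  obtains n where "\<And>m. m \<in> keys (p :: poly5) \<Longrightarrow> edeg m \<le> n"
proof
  show "edeg m \<le> Max (edeg ` keys p)" if "m \<in> keys p" for m
    using that by (intro Max_ge) auto
qed

subsection \<open>Homogeneous ideals and the Nullstellensatz\<close>

global_interpretation pvs: vector_space "\<lambda>c (p :: poly5). mv_const c * p"
  by unfold_locales (fact distrib_left | simp only: mv_const_simps distrib_right mult.assoc mult_1)+

declare pvs.scale_scale [simp del]

lemma subspace_ideal_simps:
  assumes "ideal.subspace M"
  shows "p \<in> M \<Longrightarrow> q \<in> M \<Longrightarrow> p + q \<in> M" "p \<in> M \<Longrightarrow> q \<in> M \<Longrightarrow> p - q \<in> M"
    "p \<in> M \<Longrightarrow> r * p \<in> M" "p \<in> M \<Longrightarrow> p * r \<in> M" "p \<in> M \<Longrightarrow> - p \<in> M" "0 \<in> M"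
proof -
  show "p \<in> M \<Longrightarrow> p * r \<in> M" using ideal.subspace_scale[OF assms, of p r] by (simp only: mult.commute)
qed (fact ideal.subspace_add[OF assms] ideal.subspace_diff[OF assms] ideal.subspace_scale[OF assms]
  ideal.subspace_neg[OF assms] ideal.subspace_0[OF assms])+

text \<open>An ideal generated by forms is graded. Hence congruences modulo such ideals can be cut
  down to one degree, which makes cofactors homogeneous.\<close>

lemma hcomp_span:
  assumes S: "\<And>s. s \<in> S \<Longrightarrow> \<exists>e. s \<in> forms e" and p: "p \<in> ideal.span S"
  shows "hcomp d p \<in> ideal.span S"
  using p
proof (induction rule: ideal.span_induct_alt)
  case base
  then show ?case by (simp add: ideal.span_zero)
next
  case (step c x y)
  then obtain e where "x \<in> forms e" using S by blast
  then have "hcomp d (c * x) \<in> ideal.span S"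
    by (auto simp: hcomp_mult_forms ideal.span_zero intro: ideal.span_scale ideal.span_base step)
  with step show ?case by (simp add: hcomp_add ideal.span_add)
qed

text \<open>Zorn's lemma for the ideals that contain \<open>J\<close> and avoid 1. The last conjunct
  says that the residue ring is a field, the form in which maximality is used later.\<close>

lemma maximal_ideal_exists:
  assumes J: "ideal.subspace J" "1 \<notin> J"
  shows "\<exists>M. ideal.subspace M \<and> J \<subseteq> M \<and> 1 \<notin> M \<and> (\<forall>g. g \<notin> M \<longrightarrow> (\<exists>h. g * h - 1 \<in> M))"
proof -
  let ?A = "{I. ideal.subspace I \<and> J \<subseteq> I \<and> 1 \<notin> I}"
  have "\<exists>M\<in>?A. \<forall>X\<in>?A. M \<subseteq> X \<longrightarrow> X = M"
  proof (rule subset_Zorn_nonempty)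
    fix \<C> assume ne: "\<C> \<noteq> {}" and chain: "subset.chain ?A \<C>"
    then have A: "\<C> \<subseteq> ?A" and tot: "\<And>X Y. X \<in> \<C> \<Longrightarrow> Y \<in> \<C> \<Longrightarrow> X \<subseteq> Y \<or> Y \<subseteq> X"
      by (auto simp: subset.chain_def)
    have "ideal.subspace (\<Union>\<C>)"
      unfolding ideal.subspace_def
    proof (intro conjI ballI allI)
      show "0 \<in> \<Union>\<C>" using ne A ideal.subspace_0 by blast
    next
      fix x y assume "x \<in> \<Union>\<C>" "y \<in> \<Union>\<C>"
      then obtain Z where "Z \<in> \<C>" "x \<in> Z" "y \<in> Z" using tot by (meson UnionE subsetD)
      then show "x + y \<in> \<Union>\<C>" using A ideal.subspace_add[of Z x y] by blast
    next
      fix c x assume "x \<in> \<Union>\<C>"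
      then obtain Z where "Z \<in> \<C>" "x \<in> Z" by blast
      then show "c * x \<in> \<Union>\<C>" using A ideal.subspace_scale[of Z x c] by blast
    qed
    with ne A show "\<Union>\<C> \<in> ?A" by blast
  qed (use J in auto)
  then obtain M where M: "ideal.subspace M" "J \<subseteq> M" "1 \<notin> M"
    and max: "\<And>X. ideal.subspace X \<Longrightarrow> J \<subseteq> X \<Longrightarrow> 1 \<notin> X \<Longrightarrow> M \<subseteq> X \<Longrightarrow> X = M"
    by auto
  have "\<exists>h. g * h - 1 \<in> M" if "g \<notin> M" for g
  proof -
    let ?X = "ideal.span (insert g M)"
    have sub: "M \<subseteq> ?X" and g: "g \<in> ?X" by (auto intro: ideal.span_base)
    with \<open>g \<notin> M\<close> have "?X \<noteq> M" by blast
    with max[of ?X] sub M(2) have "1 \<in> ?X" by auto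
    moreover have "ideal.span M = M" using M(1) by (simp only: ideal.span_eq_iff)
    ultimately obtain k where "1 - k * g \<in> M" by (auto simp only: ideal.span_insert)
    then have "- (1 - k * g) \<in> M" by (rule subspace_ideal_simps(5)[OF M(1)])
    then show ?thesis by (auto simp: mult.commute)
  qed
  with M show ?thesis by (intro exI[of _ M] conjI allI impI)
qed

section \<open>Residue fields of maximal ideals and the Nullstellensatz\<close>

definition upoly_eval :: "poly5 \<Rightarrow> complex poly \<Rightarrow> poly5" where
  "upoly_eval x q = poly (map_poly mv_const q) x"

lemma upoly_eval_0 [simp]: "upoly_eval x 0 = 0"
  by (simp add: upoly_eval_def)

lemma upoly_eval_pCons [simp]: "upoly_eval x (pCons a q) = mv_const a + x * upoly_eval x q"
  by (cases "a = 0 \<and> q = 0") (auto simp: upoly_eval_def map_poly_pCons)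

lemma upoly_eval_add [simp]: "upoly_eval x (p + q) = upoly_eval x p + upoly_eval x q"
proof (induction p arbitrary: q)
  case (pCons a p)
  then show ?case by (cases q) (simp add: algebra_simps)
qed simp

lemma upoly_eval_smult [simp]: "upoly_eval x (smult c q) = mv_const c * upoly_eval x q"
  by (induction q) (simp_all add: algebra_simps)

lemma upoly_eval_mult [simp]: "upoly_eval x (p * q) = upoly_eval x p * upoly_eval x q"
  by (induction p) (simp_all add: algebra_simps)

lemma upoly_eval_sum [simp]: "upoly_eval x (sum g S) = (\<Sum>s\<in>S. upoly_eval x (g s))"
  by (induction S rule: infinite_finite_induct) auto

lemma upoly_eval_1 [simp]: "upoly_eval x 1 = 1"
  by (simp add: one_pCons)

lemma upoly_eval_prod [simp]: "upoly_eval x (prod g S) = (\<Prod>s\<in>S. upoly_eval x (g s))"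
  by (induction S rule: infinite_finite_induct) auto

text \<open>If \<open>x - c\<close> were invertible modulo \<open>M\<close> for all complex \<open>c\<close>, the uncountably many inverses would
  be linearly dependent, so \<open>x\<close> would be algebraic over the algebraically closed field \<open>\<complex>\<close>.\<close>

lemma maximal_ideal_residue:
  assumes M: "ideal.subspace M" "1 \<notin> M" "\<And>g. g \<notin> M \<Longrightarrow> \<exists>h. g * h - 1 \<in> M"
  shows "\<exists>c. x - mv_const c \<in> M"
proof (rule ccontr)
  assume "\<nexists>c. x - mv_const c \<in> M"
  then have "\<forall>c. \<exists>h. (x - mv_const c) * h - 1 \<in> M" using M(3) by blast
  then obtain h where h: "\<And>c. (x - mv_const c) * h c - 1 \<in> M" by metis
  note Msub = subspace_ideal_simps[OF M(1)]
  have const: "mv_const c * p \<in> M \<Longrightarrow> c \<noteq> 0 \<Longrightarrow> p \<in> M" for c p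
  proof -
    assume "mv_const c * p \<in> M" and "c \<noteq> 0"
    from this(1) have "mv_const (inverse c) * (mv_const c * p) \<in> M" by (rule Msub(3))
    moreover have "mv_const (inverse c) * (mv_const c * p) = mv_const (inverse c * c) * p"
      by (simp only: mv_const_simps mult.assoc)
    ultimately show "p \<in> M" using \<open>c \<noteq> 0\<close> by simp
  qed
  \<comment> \<open>\<open>x\<close> is transcendental modulo \<open>M\<close>: a root
    \<open>r\<close> of \<open>q\<close> splits off the factor \<open>x - r\<close>, which is
    invertible modulo \<open>M\<close>, and the degree drops.\<close>
  have transc: "upoly_eval x q \<notin> M" if "q \<noteq> 0" for q
    using that
  proof (induction "degree q" arbitrary: q)
    case 0
    then obtain a where "q = [:a:]" "a \<noteq> 0" by (metis degree_eq_zeroE pCons_0_0)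
    then show ?case using const[of a 1] M(2) by auto
  next
    case (Suc n)
    then have "\<not> constant (poly q)" by (simp add: constant_degree)
    then obtain r where "poly q r = 0" using fundamental_theorem_of_algebra by blast
    then obtain q' where q': "q = [:- r, 1:] * q'" by (auto simp: poly_eq_0_iff_dvd)
    with Suc have "q' \<noteq> 0" "degree q' = n" by (auto simp: degree_mult_eq simp del: mult_pCons_left)
    then have not: "upoly_eval x q' \<notin> M" using Suc by blast
    show ?case
    proof
      assume "upoly_eval x q \<in> M"
      then have "h r * upoly_eval x q \<in> M" by (rule Msub)
      moreover have "h r * upoly_eval x q
          = upoly_eval x q' + upoly_eval x q' * ((x - mv_const r) * h r - 1)"
        unfolding q' upoly_eval_mult by (simp add: algebra_simps)
      ultimately have "upoly_eval x q' + upoly_eval x q' * ((x - mv_const r) * h r - 1) \<in> M" by simp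
      moreover have "upoly_eval x q' * ((x - mv_const r) * h r - 1) \<in> M" by (intro Msub h)
      ultimately show False using not Msub(2) by fastforce
    qed
  qed
  \<comment> \<open>Countably many sets \<open>A n\<close> cover the uncountable field, so one of
    them is infinite, while the inverses it indexes lie in the finite-dimensional space of
    polynomials of degree at most \<open>n\<close>.\<close>
  define A where "A n = {c. \<forall>m\<in>keys (h c). edeg m \<le> n}" for n
  have "(\<Union>n. A n) = UNIV" proof (intro equalityI subset_UNIV subsetI)
    fix c
    obtain n where "\<And>m. m \<in> keys (h c) \<Longrightarrow> edeg m \<le> n" using degree_bound_exists by blast
    then show "c \<in> (\<Union>n. A n)" by (auto simp: A_def)
  qed
  moreover have "uncountable (UNIV :: complex set)"
    by (rule uncountable_UNIV_complex)
  ultimately obtain n where inf: "infinite (A n)"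
    using countable_UN[of "UNIV :: nat set" A] countable_finite by fastforce
  let ?T = "(\<lambda>m. single m 1 :: poly5) ` {m. edeg m \<le> n}"
  have span: "h ` A n \<subseteq> pvs.span ?T"
  proof
    fix p assume p: "p \<in> h ` A n"
    have "single m (lookup p m) \<in> pvs.span ?T" if "m \<in> keys p" for m
      by (subst single_eq_const_mult, rule pvs.span_scale[OF pvs.span_base])
        (use that p in \<open>auto simp: A_def\<close>)
    then have "(\<Sum>m\<in>keys p. single m (lookup p m)) \<in> pvs.span ?T" by (intro pvs.span_sum)
    then show "p \<in> pvs.span ?T" by (simp add: sum_single_lookup)
  qed
  have inj: "inj h"
  proof (rule injI, rule ccontr)
    fix c d assume "h c = h d" "c \<noteq> d"
    have "((x - mv_const c) * h c - 1) - ((x - mv_const d) * h c - 1) \<in> M"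
      using Msub(2)[OF h[of c] h[of d]] \<open>h c = h d\<close> by simp
    moreover have "((x - mv_const c) * h c - 1) - ((x - mv_const d) * h c - 1) = mv_const (d - c) * h c"
      by (simp add: algebra_simps)
    ultimately have "mv_const (d - c) * h c \<in> M" by (simp only:)
    then have "h c \<in> M" using const[of "d - c"] \<open>c \<noteq> d\<close> by simp
    then have "(x - mv_const c) * h c - ((x - mv_const c) * h c - 1) \<in> M"
      by (rule Msub(2)[OF Msub(3) h])
    then show False using M(2) by simp
  qed
  have "infinite (h ` A n)" using inf inj by (meson finite_imageD inj_on_subset subset_UNIV)
  then have "pvs.dependent (h ` A n)"
    using pvs.independent_span_bound[OF _ _ span] finite_edeg_le by blast
  then obtain S u v where S: "finite S" "S \<subseteq> h ` A n" "(\<Sum>p\<in>S. mv_const (u p) * p) = 0"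
      "v \<in> S" "u v \<noteq> 0"
    unfolding pvs.dependent_explicit by blast
  then obtain C where C: "finite C" "S = h ` C" by (meson finite_subset_image)
  define a where "a c = u (h c)" for c
  have sum0: "(\<Sum>c\<in>C. mv_const (a c) * h c) = 0"
    using S(3) unfolding C(2) a_def by (subst (asm) sum.reindex) (use inj in \<open>auto intro: inj_on_subset\<close>)
  obtain c0 where c0: "c0 \<in> C" "a c0 \<noteq> 0" using S C by (auto simp: a_def)
  \<comment> \<open>The numerator of the linear relation between the fractions 1/(x - c) after
    clearing denominators. At \<open>c0\<close> only the summand of \<open>c0\<close>
    survives.\<close>
  define q where "q = (\<Sum>c\<in>C. smult (a c) (\<Prod>d\<in>C-{c}. [:- d, 1:]))"
  have "poly q c0 = (\<Sum>c\<in>C. if c = c0 then a c0 * (\<Prod>d\<in>C-{c0}. c0 - d) else 0)"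
    unfolding q_def poly_sum
    by (rule sum.cong) (use C c0 in \<open>auto simp: poly_prod prod_zero_iff\<close>)
  then have "poly q c0 \<noteq> 0" using C c0 by simp
  then have "q \<noteq> 0" by auto
  then have "upoly_eval x q \<notin> M" by (rule transc)
  moreover have "upoly_eval x q \<in> M"
  proof -
    let ?P = "\<lambda>D. \<Prod>d\<in>D. x - mv_const d"
    have eq: "mv_const (a c) * ?P (C - {c}) = ?P C * (mv_const (a c) * h c)
        - mv_const (a c) * ?P (C - {c}) * ((x - mv_const c) * h c - 1)" if "c \<in> C" for c
      by (simp add: prod.remove[OF C(1) that] algebra_simps)
    have "upoly_eval x q = (\<Sum>c\<in>C. mv_const (a c) * ?P (C - {c}))"
      by (simp add: q_def algebra_simps)
    also have "\<dots> = (\<Sum>c\<in>C. ?P C * (mv_const (a c) * h c)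
        - mv_const (a c) * ?P (C - {c}) * ((x - mv_const c) * h c - 1))"
      by (rule sum.cong) (simp, rule eq)
    also have "\<dots> = ?P C * (\<Sum>c\<in>C. mv_const (a c) * h c)
        - (\<Sum>c\<in>C. mv_const (a c) * ?P (C - {c}) * ((x - mv_const c) * h c - 1))"
      by (simp only: sum_subtractf sum_distrib_left)
    also have "\<dots> \<in> M"
      unfolding sum0
      by (rule Msub(2)[OF _ ideal.subspace_sum[OF M(1) Msub(3)[OF h]]]) (simp add: Msub(6))
    finally show ?thesis .
  qed
  ultimately show False by contradiction
qed

lemma single_eq_prod_var: "single m 1 = (\<Prod>i\<in>UNIV. var i ^ lookup m i :: (_, 'a::comm_semiring_1) mvpoly)"
  for m :: "'v::finite \<Rightarrow>\<^sub>0 nat"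
proof -
  have "(\<Prod>i\<in>S. var i ^ lookup m i :: (_, 'a) mvpoly) = single (\<Sum>i\<in>S. single i (lookup m i)) 1"
    if "finite S" for S
    using that by induction (auto simp: var_power mult_single)
  moreover have "(\<Sum>i\<in>UNIV. single i (lookup m i)) = m"
    by (rule poly_mapping_eqI) (simp add: lookup_sum lookup_single when_def)
  ultimately show ?thesis by simp
qed

lemma ideal_mod_eval:
  assumes M: "ideal.subspace M" "\<And>i. var i - mv_const (v i) \<in> M"
  shows "p - mv_const (mv_eval p v) \<in> M"
proof -
  note Msub = subspace_ideal_simps[OF M(1)]
  have mult: "p * q - mv_const (a * b) \<in> M" if "p - mv_const a \<in> M" "q - mv_const b \<in> M" for p q a b
  proof -
    have "(p - mv_const a) * q + mv_const a * (q - mv_const b) \<in> M"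
      by (rule Msub(1)[OF Msub(4)[OF that(1)] Msub(3)[OF that(2)]])
    then show ?thesis by (simp add: algebra_simps)
  qed
  have pow: "var i ^ n - mv_const (v i ^ n) \<in> M" for i n
    by (induction n) (use Msub(6) mult M(2) in auto)
  have prod: "(\<Prod>i\<in>S. var i ^ lookup m i) - mv_const (\<Prod>i\<in>S. v i ^ lookup m i) \<in> M" 
    if "finite S" for S m
    using that by induction (use Msub(6) mult pow in auto)
  show ?thesis
  proof (induction p rule: mv_induct)
    case (single m c)
    have "single m 1 - mv_const (mon_eval v m) \<in> M"
      using prod[of UNIV m] by (simp add: single_eq_prod_var mon_eval_UNIV)
    then have "mv_const c * single m 1 - mv_const (c * mon_eval v m) \<in> M"
      by (intro mult) (simp_all add: Msub(6))
    then show ?case by (simp flip: single_eq_const_mult)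
  next
    case (add p q)
    then show ?case using Msub(1) by (fastforce simp: algebra_simps)
  qed
qed

text \<open>Dehomogenize by adding \<open>var i - 1\<close>. If this gives the unit ideal, comparing
  degrees produces a power of \<open>var i\<close>; otherwise the residues of the variables modulo a
  maximal ideal are a common zero whose coordinate \<open>i\<close> is 1.\<close>

theorem projective_nullstellensatz:
  assumes S: "\<And>s. s \<in> S \<Longrightarrow> \<exists>e. s \<in> forms e"
    and nz: "\<And>v :: complex ^ 5. v \<noteq> 0 \<Longrightarrow> \<exists>s\<in>S. mv_eval s (($) v) \<noteq> 0"
  shows "\<exists>n. var i ^ n \<in> ideal.span S"
proof (rule ccontr)
  assume no: "\<nexists>n. var i ^ n \<in> ideal.span S"
  let ?J = "ideal.span (insert (var i - 1) S)"
  have "1 \<notin> ?J"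
  proof
    assume "1 \<in> ?J"
    then obtain k where "1 - k * (var i - 1) \<in> ideal.span S"
      by (auto simp: ideal.span_insert)
    then have comp: "hcomp d (1 + k - k * var i) \<in> ideal.span S" for d
      using hcomp_span[OF S] by (auto simp: algebra_simps)
    have one: "(1 :: poly5) \<in> forms 0" using mv_const_forms[of 1] by simp
    have x: "hcomp d (k * var i) = (if 1 \<le> d then hcomp (d - 1) k * var i else 0)" for d
      by (rule hcomp_mult_forms) (rule forms_var)
    \<comment> \<open>The relation links consecutive components of \<open>k\<close>, so the powers
      of \<open>var i\<close> accumulate. Beyond the degree of \<open>k\<close> only the power is
      left.\<close>
    have "hcomp d k + var i ^ d \<in> ideal.span S" for d
    proof (induction d)
      case 0
      then show ?case using comp[of 0] by (simp add: hcomp_add hcomp_diff x hcomp_of_forms[OF one] add.commute)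
    next
      case (Suc d)
      have "hcomp (Suc d) k - hcomp d k * var i \<in> ideal.span S"
        using comp[of "Suc d"] by (simp add: hcomp_add hcomp_diff x hcomp_of_forms[OF one])
      then have "(hcomp (Suc d) k - hcomp d k * var i) + var i * (hcomp d k + var i ^ d) \<in> ideal.span S"
        by (rule ideal.span_add[OF _ ideal.span_scale[OF Suc]])
      then show ?case by (simp add: algebra_simps)
    qed
    moreover obtain n where n: "\<And>m. m \<in> keys k \<Longrightarrow> edeg m \<le> n" using degree_bound_exists by blast
    then have "hcomp (Suc n) k = 0"
      by (intro poly_mapping_eqI) (force simp: lookup_hcomp in_keys_iff)
    ultimately show False using no by (metis add_0)
  qed
  then obtain M where M: "ideal.subspace M" "?J \<subseteq> M" "1 \<notin> M" "\<And>g. g \<notin> M \<Longrightarrow> \<exists>h. g * h - 1 \<in> M"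
    using maximal_ideal_exists[OF ideal.subspace_span] by blast
  note Msub = subspace_ideal_simps[OF M(1)]
  have "\<exists>c. var j - mv_const c \<in> M" for j
    by (rule maximal_ideal_residue) (use M in auto)
  then obtain w where w: "\<And>j. var j - mv_const (w j) \<in> M" by metis
  have unit: "a = 0" if "mv_const a \<in> M" for a
  proof (rule ccontr)
    assume "a \<noteq> 0"
    have "mv_const (inverse a) * mv_const a \<in> M" using that by (rule Msub)
    moreover have "mv_const (inverse a) * mv_const a = (1 :: poly5)"
      using \<open>a \<noteq> 0\<close> by (metis left_inverse mv_const_simps(2,4))
    ultimately show False using M(3) by simp
  qed
  have zero: "mv_eval p w = 0" if "p \<in> M" for p
  proof (rule unit)
    have "p - (p - mv_const (mv_eval p w)) \<in> M"
      by (rule Msub(2)[OF that ideal_mod_eval[OF M(1) w]])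
    then show "mv_const (mv_eval p w) \<in> M" by simp
  qed
  have J: "insert (var i - 1) S \<subseteq> M" using M(2) ideal.span_superset by blast
  have w_eq: "($) (\<chi> j. w j) = w" by (rule ext) simp
  from J zero[of "var i - 1"] have "w i = 1" by simp
  then have "(\<chi> j. w j) \<noteq> 0" by (auto simp: vec_eq_iff intro: exI[of _ i])
  from nz[OF this] zero J show False by (auto simp: w_eq)
qed

subsection \<open>Permutable regular sequences and socles\<close>

text \<open>Regularity is demanded modulo every set \<open>A\<close> of other elements and not only
  modulo initial segments, so no order is singled out and an element at any position can be
  exchanged.\<close>

definition permutably_regular :: "(5 \<Rightarrow> poly5) \<Rightarrow> bool" where
  "permutably_regular t \<longleftrightarrow>
    (\<forall>A i u. i \<notin> A \<longrightarrow> t i * u \<in> ideal.span (t ` A) \<longrightarrow> u \<in> ideal.span (t ` A))"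

text \<open>For an ideal \<open>I\<close> generated by forms, this says that the quotient is an Artinian Gorenstein ring
  whose socle is spanned by the class of \<open>s\<close>.\<close>

definition gorenstein :: "poly5 set \<Rightarrow> nat \<Rightarrow> bool" where
  "gorenstein I e \<longleftrightarrow> (\<exists>s\<in>forms e. s \<notin> I \<and> (\<forall>g. g \<notin> I \<longrightarrow> (\<exists>h. g * h - s \<in> I)))"

lemmas span_simps = subspace_ideal_simps[OF ideal.subspace_span]

text \<open>Membership in a monomial ideal is decided monomial by monomial. This settles both
  properties of the system of variables, where the exchange starts.\<close>

lemma mem_span_vars: "p \<in> ideal.span (var ` A) \<longleftrightarrow> (\<forall>m\<in>keys p. \<exists>i\<in>A. lookup m i > 0)"
proof
  assume "p \<in> ideal.span (var ` A)"
  then show "\<forall>m\<in>keys p. \<exists>i\<in>A. lookup m i > 0"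
  proof (induction rule: ideal.span_induct_alt)
    case (step c x y)
    then obtain i where i: "i \<in> A" "x = var i" by blast
    show ?case
    proof
      fix m assume "m \<in> keys (c * x + y)"
      then have "m \<in> keys y \<or> lookup (var i * c) m \<noteq> 0"
        by (auto simp: i in_keys_iff lookup_add mult.commute)
      then show "\<exists>i\<in>A. lookup m i > 0"
      proof
        assume "lookup (var i * c) m \<noteq> 0"
        then obtain k where "m = single i 1 + k"
          unfolding var_def using lookup_single_mult_eq_0 by blast
        then show ?thesis using i(1) by (intro bexI[of _ i]) (auto simp: lookup_add)
      qed (use step in blast)
    qed
  qed simp
next
  assume *: "\<forall>m\<in>keys p. \<exists>i\<in>A. lookup m i > 0"
  have "(\<Sum>m\<in>keys p. single m (lookup p m)) \<in> ideal.span (var ` A)"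
  proof (rule ideal.span_sum)
    fix m assume "m \<in> keys p"
    then obtain i where i: "i \<in> A" "lookup m i > 0" using * by blast
    then have "m = single i 1 + (m - single i 1)" by (intro exponent_split) simp
    then have "single m (lookup p m) = single (m - single i 1) (lookup p m) * var i"
      by (simp add: var_def mult_single add.commute)
    then show "single m (lookup p m) \<in> ideal.span (var ` A)"
      using i(1) by (simp add: ideal.span_scale ideal.span_base)
  qed
  then show "p \<in> ideal.span (var ` A)" by (simp add: sum_single_lookup)
qed

lemma permutably_regular_var: "permutably_regular var"
  unfolding permutably_regular_def mem_span_vars
proof (intro allI impI ballI)
  fix A and i :: 5 and u :: poly5 and m
  assume "i \<notin> A" and *: "\<forall>m\<in>keys (var i * u). \<exists>i\<in>A. 0 < lookup m i" and "m \<in> keys u"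
  have "single i 1 + m \<in> keys (var i * u)"
    using \<open>m \<in> keys u\<close> by (simp add: in_keys_iff var_def lookup_single_mult)
  with * obtain j where "j \<in> A" "0 < lookup (single i 1 + m) j" by blast
  moreover from this \<open>i \<notin> A\<close> have "i \<noteq> j" by blast
  ultimately show "\<exists>j\<in>A. 0 < lookup m j" by (auto simp: lookup_add lookup_single)
qed

text \<open>The quotient is the field of constants, and 1 generates its socle.\<close>

lemma gorenstein_var: "gorenstein (ideal.span (range var)) 0"
proof -
  have mem: "p \<in> ideal.span (range var) \<longleftrightarrow> lookup p 0 = 0" for p
  proof -
    have "(\<exists>i. lookup m i > 0) \<longleftrightarrow> m \<noteq> 0" for m :: "5 \<Rightarrow>\<^sub>0 nat"
      by (metis gr0I lookup_zero poly_mapping_eqI less_numeral_extra(3))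
    then show ?thesis unfolding mem_span_vars by (auto simp: in_keys_iff)
  qed
  show ?thesis
    unfolding gorenstein_def mem
  proof (intro bexI conjI allI impI)
    show "(1 :: poly5) \<in> forms 0" using mv_const_forms[of 1] by simp
    fix g :: poly5 assume g: "lookup g 0 \<noteq> 0"
    have "lookup (g * mv_const (inverse (lookup g 0)) - 1) 0 = 0"
      by (subst mult.commute) (simp add: lookup_minus lookup_one g)
    then show "\<exists>h. lookup (g * h - 1) 0 = 0" ..
  qed simp
qed

text \<open>All elements of the ideal vanish at the origin.\<close>

lemma one_notin_span:
  assumes "\<And>s. s \<in> S \<Longrightarrow> \<exists>d>0. s \<in> forms d"
  shows "1 \<notin> ideal.span S"
proof
  have "mv_eval p (\<lambda>_. 0) = 0" if "p \<in> ideal.span S" for p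
    using that
  proof (induction rule: ideal.span_induct_alt)
    case (step c x y)
    then obtain d where "d > 0" "x \<in> forms d" using assms by blast
    then have "mv_eval x (\<lambda>_. 0) = 0" using mv_eval_forms_scale[of x d 0 "\<lambda>_. 0"]
      by (simp add: power_0_left)
    with step show ?case by simp
  qed simp
  moreover assume "1 \<in> ideal.span S"
  ultimately show False by fastforce
qed

lemma nonzerodivisor_power:
  fixes w :: poly5
  assumes "\<And>u. w * u \<in> K \<Longrightarrow> u \<in> K" "w ^ n * u \<in> K"
  shows "u \<in> K"
  using assms(2) by (induction n) (auto simp: mult.assoc dest: assms(1))

text \<open>By iteration, an annihilated class lies in every power of the ideal generated by \<open>w\<close>, hence
  vanishes for degree reasons.\<close>

lemma nonzerodivisor_remove:
  assumes S: "\<And>s. s \<in> S \<Longrightarrow> \<exists>e. s \<in> forms e"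
    and w: "w \<in> forms d" "d > 0" "\<And>u. w * u \<in> ideal.span S \<Longrightarrow> u \<in> ideal.span S"
    and f: "\<And>u. f * u \<in> ideal.span (insert w S) \<Longrightarrow> u \<in> ideal.span (insert w S)"
    and u: "f * u \<in> ideal.span S"
  shows "u \<in> ideal.span S"
proof -
  let ?K = "ideal.span S"
  have sub: "?K \<subseteq> ideal.span (insert w S)" by (rule ideal.span_mono) auto
  have iter: "\<exists>u'. u - w ^ n * u' \<in> ?K \<and> f * u' \<in> ?K" for n
  proof (induction n)
    case 0
    then show ?case using u by (intro exI[of _ u]) (simp add: ideal.span_zero)
  next
    case (Suc n)
    then obtain u' where u': "u - w ^ n * u' \<in> ?K" "f * u' \<in> ?K" by blast
    then have "u' \<in> ideal.span (insert w S)" using f sub by blast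
    then obtain k where k: "u' - k * w \<in> ?K" unfolding ideal.span_insert by blast
    have "f * u' - f * (u' - k * w) \<in> ?K" by (rule span_simps(2)[OF u'(2) span_simps(3)[OF k]])
    then have "w * (f * k) \<in> ?K" by (simp add: algebra_simps)
    then have "f * k \<in> ?K" by (rule w(3))
    moreover have "(u - w ^ n * u') + w ^ n * (u' - k * w) \<in> ?K"
      by (rule span_simps(1)[OF u'(1) span_simps(3)[OF k]])
    then have "u - w ^ Suc n * k \<in> ?K" by (simp add: algebra_simps)
    ultimately show ?case by blast
  qed
  obtain n where n: "\<And>m. m \<in> keys u \<Longrightarrow> edeg m \<le> n" using degree_bound_exists by blast
  obtain u' where u': "u - w ^ Suc n * u' \<in> ?K" using iter by blast
  have "hcomp e u \<in> ?K" if "e \<le> n" for e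
  proof -
    have "Suc n \<le> Suc n * d" using \<open>d > 0\<close> mult_le_mono2[of 1 d "Suc n"] by simp
    then have "hcomp e (u' * w ^ Suc n) = 0"
      using that by (subst hcomp_mult_forms[OF forms_power[OF w(1)]]) auto
    then have "hcomp e u = hcomp e (u - w ^ Suc n * u')"
      by (simp add: hcomp_diff mult.commute[of "w ^ Suc n"] del: power_Suc)
    then show ?thesis using hcomp_span[OF S u'] by simp
  qed
  then have "(\<Sum>e\<le>n. hcomp e u) \<in> ?K" by (intro ideal.span_sum) auto
  then show ?thesis using n by (simp add: sum_hcomp)
qed

text \<open>The power of \<open>t k\<close> in the new ideal makes \<open>f\<close> a nonzerodivisor
  modulo all the other elements together. \<open>nonzerodivisor_remove\<close> then drops these one
  at a time, which explains the induction on the complement of \<open>A\<close>.\<close>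

lemma permutably_regular_exchange:
  assumes reg: "permutably_regular t" and t: "\<And>i. \<exists>d>0. t i \<in> forms d"
    and N: "t k ^ N \<in> ideal.span (range (t(k := f)))"
  shows "permutably_regular (t(k := f))"
proof -
  have nzd: "u \<in> ideal.span (t ` A)" if "t i * u \<in> ideal.span (t ` A)" "i \<notin> A" for i u A
    using reg that unfolding permutably_regular_def by blast
  have hom: "\<exists>e. s \<in> forms e" if "s \<in> t ` A" for s A using t that by blast
  have f: "u \<in> ideal.span (t ` A)" if "k \<notin> A" "f * u \<in> ideal.span (t ` A)" for A u
    using that
  proof (induction "card (- A)" arbitrary: A u rule: less_induct)
    case less
    show ?case
    proof (cases "A = - {k}")
      case True
      have "range (t(k := f)) = insert f (t ` A)" using True by (auto simp: image_iff)
      with N have "t k ^ N \<in> ideal.span (insert f (t ` A))" by (simp only:)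
      then obtain a where a: "t k ^ N - a * f \<in> ideal.span (t ` A)"
        unfolding ideal.span_insert by blast
      have "u * (t k ^ N - a * f) + a * (f * u) \<in> ideal.span (t ` A)"
        by (rule span_simps(1)[OF span_simps(3)[OF a] span_simps(3)[OF less(3)]])
      then have "t k ^ N * u \<in> ideal.span (t ` A)" by (simp add: algebra_simps)
      then show ?thesis by (rule nonzerodivisor_power[rotated]) (use nzd less in blast)
    next
      case False
      then obtain j where j: "j \<notin> A" "j \<noteq> k" using less(2) by blast
      obtain d where d: "d > 0" "t j \<in> forms d" using t by blast
      have "card (- insert j A) < card (- A)" by (rule psubset_card_mono) (use j in auto)
      from less.hyps[OF this] have f': "v \<in> ideal.span (insert (t j) (t ` A))"
        if "f * v \<in> ideal.span (insert (t j) (t ` A))" for v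
        using that j less(2) by auto
      show ?thesis
        by (rule nonzerodivisor_remove[OF hom d(2,1) nzd[OF _ j(1)] f' less(3)])
    qed
  qed
  show ?thesis
    unfolding permutably_regular_def
  proof (intro allI impI)
    fix A i u
    assume i: "i \<notin> A" and u: "(t(k := f)) i * u \<in> ideal.span (t(k := f) ` A)"
    show "u \<in> ideal.span (t(k := f) ` A)"
    proof (cases "k \<in> A")
      case False
      then have "t(k := f) ` A = t ` A" by auto
      then show ?thesis using u f[OF False] nzd[OF _ i, of u] by (cases "i = k") auto
    next
      case True
      \<comment> \<open>Regular elements are swapped here. In \<open>t i * u = h * f\<close> modulo
        \<open>B\<close>, regularity of \<open>f\<close> modulo \<open>B\<close> and
        \<open>t i\<close> makes \<open>h\<close> a multiple \<open>h' * t i\<close>; then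
        \<open>t i\<close> cancels.\<close>
      define B where "B = A - {k}"
      have im: "t(k := f) ` A = insert f (t ` B)" using True by (auto simp: B_def image_iff)
      have ik: "i \<noteq> k" "i \<notin> B" "k \<notin> B" using i True by (auto simp: B_def)
      from u obtain h where h: "t i * u - h * f \<in> ideal.span (t ` B)"
        using ik unfolding im ideal.span_insert by auto
      have sub: "ideal.span (t ` B) \<subseteq> ideal.span (t ` insert i B)" by (rule ideal.span_mono) auto
      have "u * t i - (t i * u - h * f) \<in> ideal.span (t ` insert i B)"
        by (rule span_simps(2)[OF span_simps(3)]) (use h sub in \<open>auto intro: ideal.span_base\<close>)
      then have "f * h \<in> ideal.span (t ` insert i B)" by (simp add: mult.commute)
      then have "h \<in> ideal.span (t ` insert i B)" by (rule f[rotated]) (use ik in auto)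
      then obtain h' where h': "h - h' * t i \<in> ideal.span (t ` B)"
        by (auto simp: ideal.span_insert)
      have "(t i * u - h * f) + f * (h - h' * t i) \<in> ideal.span (t ` B)"
        by (rule span_simps(1)[OF h span_simps(3)[OF h']])
      then have "t i * (u - h' * f) \<in> ideal.span (t ` B)" by (simp add: algebra_simps)
      then have "u - h' * f \<in> ideal.span (t ` B)" by (rule nzd) (rule ik)
      then show ?thesis unfolding im ideal.span_insert by blast
    qed
  qed
qed

text \<open>The socle passes from \<open>K + (x)\<close> to \<open>K + (x^(M + 2))\<close> by multiplication with \<open>x^(M + 1)\<close>, and from
  there to \<open>K + (f)\<close> by division by \<open>a\<close>, where \<open>x^(M + 2)\<close> is congruent to \<open>a f\<close> modulo \<open>K\<close>.\<close>

lemma gorenstein_exchange: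
  assumes S: "\<And>s. s \<in> S \<Longrightarrow> \<exists>d>0. s \<in> forms d"
    and x: "x \<in> forms 1" "\<And>u. x * u \<in> ideal.span S \<Longrightarrow> u \<in> ideal.span S"
    and f: "f \<in> forms 2" "x ^ N \<in> ideal.span (insert f S)"
    and gor: "gorenstein (ideal.span (insert x S)) e"
  shows "gorenstein (ideal.span (insert f S)) (e + 1)"
proof -
  let ?K = "ideal.span S"
  let ?I = "ideal.span (insert f S)"
  let ?I1 = "ideal.span (insert x S)"
  \<comment> \<open>The exponent \<open>M + 2\<close> is chosen so that the cofactor
    \<open>a\<close> of the quadric \<open>f\<close> has degree \<open>M\<close>.\<close>
  define M where "M = N"
  let ?IN = "ideal.span (insert (x ^ (M + 2)) S)"
  have hom: "\<exists>e. s \<in> forms e" if "s \<in> S" for s using S that by blast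
  have homN: "\<exists>e. s \<in> forms e" if "s \<in> insert (x ^ (M + 2)) S" for s
    using hom that forms_power[OF x(1), of "M + 2"] by auto
  have KIN: "?K \<subseteq> ?IN" by (rule ideal.span_mono) auto
  have xIN: "k * x ^ (M + 2) \<in> ?IN" for k
    by (rule ideal.span_scale[OF ideal.span_base]) simp
  have x_pow: "u \<in> ?K" if "x ^ n * u \<in> ?K" for n u
    using x(2) that by (rule nonzerodivisor_power)
  obtain s where s: "s \<in> forms e" "s \<notin> ?I1" "\<And>g. g \<notin> ?I1 \<Longrightarrow> \<exists>h. g * h - s \<in> ?I1"
    using gor unfolding gorenstein_def by blast
  define sN where "sN = x ^ (M + 1) * s"
  have sN: "sN \<in> forms (M + 1 + e)"
    unfolding sN_def using forms_mult[OF forms_power[OF x(1), of "M + 1"] s(1)] by simp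
  have sN_notin: "sN \<notin> ?IN"
  proof
    assume "sN \<in> ?IN"
    then obtain k where "sN - k * x ^ (M + 2) \<in> ?K" unfolding ideal.span_insert by blast
    then have "x ^ (M + 1) * (s - k * x) \<in> ?K" by (simp add: sN_def algebra_simps)
    then have "s - k * x \<in> ?K" by (rule x_pow)
    then show False using s(2) unfolding ideal.span_insert by blast
  qed
  \<comment> \<open>Divide \<open>g\<close> by \<open>x\<close> modulo \<open>?K\<close> until the
    quotient \<open>h\<close> leaves \<open>?I1\<close>; this happens by exponent
    \<open>M + 1\<close>, since otherwise \<open>g\<close> would be a multiple of
    \<open>x ^ (M + 2)\<close>. A cofactor taking \<open>h\<close> to \<open>s\<close>, times the
    missing power of \<open>x\<close>, takes \<open>g\<close> to \<open>sN\<close>.\<close>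
  have gorN: "\<exists>h. g * h - sN \<in> ?IN" if g: "g \<notin> ?IN" for g
  proof -
    have "\<exists>j\<le>M + 1. \<exists>h. g - x ^ j * h \<in> ?K \<and> h \<notin> ?I1"
    proof (rule ccontr)
      assume neg: "\<not> ?thesis"
      have "\<exists>h. g - x ^ j * h \<in> ?K" if "j \<le> M + 2" for j
        using that
      proof (induction j)
        case 0
        show ?case by (rule exI[of _ g]) (simp add: ideal.span_zero)
      next
        case (Suc j)
        then obtain h where h: "g - x ^ j * h \<in> ?K" by auto
        with neg Suc.prems have "h \<in> ?I1" by auto
        then obtain k where k: "h - k * x \<in> ?K" unfolding ideal.span_insert by blast
        have "(g - x ^ j * h) + x ^ j * (h - k * x) \<in> ?K"
          by (rule span_simps(1)[OF h span_simps(3)[OF k]])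
        then show ?case by (intro exI[of _ k]) (simp add: algebra_simps)
      qed
      then obtain h where "g - x ^ (M + 2) * h \<in> ?K" by blast
      then have "g - h * x ^ (M + 2) \<in> ?K" by (simp only: mult.commute)
      then show False using g unfolding ideal.span_insert by blast
    qed
    then obtain j h where j: "j \<le> M + 1" and h: "g - x ^ j * h \<in> ?K" "h \<notin> ?I1" by blast
    obtain h' k where "h * h' - s - k * x \<in> ?K"
      using s(3)[OF h(2)] unfolding ideal.span_insert by blast
    then have "x ^ (M + 1 - j) * h' * (g - x ^ j * h) + x ^ (M + 1) * (h * h' - s - k * x) \<in> ?K"
      by (rule span_simps(1)[OF span_simps(3)[OF h(1)] span_simps(3)])
    then have "x ^ (M + 1 - j) * h' * (g - x ^ j * h) + x ^ (M + 1) * (h * h' - s - k * x)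
        + k * x ^ (M + 2) \<in> ?IN"
      by (rule span_simps(1)[OF subsetD[OF KIN] xIN])
    moreover have "x ^ (M + 1 - j) * h' * (g - x ^ j * h) + x ^ (M + 1) * (h * h' - s - k * x)
        + k * x ^ (M + 2) = g * (x ^ (M + 1 - j) * h') - sN"
    proof -
      have "x ^ (M + 1) = x ^ (M + 1 - j) * x ^ j" using j by (simp flip: power_add)
      moreover have "x ^ (M + 2) = x ^ (M + 1) * x" by simp
      ultimately show ?thesis by (simp only: sN_def) (simp only: algebra_simps)
    qed
    ultimately show ?thesis by auto
  qed
  have "x ^ 2 * x ^ N \<in> ?I" using f(2) by (rule span_simps(3))
  moreover have "x ^ 2 * x ^ N = x ^ (M + 2)" by (simp add: M_def power2_eq_square mult.assoc)
  ultimately have "x ^ (M + 2) \<in> ?I" by (simp only:)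
  then obtain a0 where a0: "x ^ (M + 2) - a0 * f \<in> ?K" unfolding ideal.span_insert by blast
  define a where "a = hcomp M a0"
  have a_form: "a \<in> forms M" unfolding a_def by (rule hcomp_forms)
  have "hcomp (M + 2) (x ^ (M + 2) - a0 * f) \<in> ?K" using hcomp_span[OF hom a0] .
  moreover have "x ^ (M + 2) \<in> forms (M + 2)" using forms_power[OF x(1), of "M + 2"] by simp
  ultimately have a: "x ^ (M + 2) - a * f \<in> ?K"
    by (simp add: hcomp_diff hcomp_of_forms hcomp_mult_forms[OF f(1)] a_def del: power_Suc)
  have a_nzd: "u \<in> ?K" if "a * u \<in> ?K" for u
  proof -
    have "u * (x ^ (M + 2) - a * f) + f * (a * u) \<in> ?K"
      by (rule span_simps(1)[OF span_simps(3)[OF a] span_simps(3)[OF that]])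
    then have "x ^ (M + 2) * u \<in> ?K" by (simp add: algebra_simps)
    then show ?thesis by (rule x_pow)
  qed
  \<comment> \<open>Thus \<open>?I\<close> is the colon ideal of \<open>?IN\<close> by
    \<open>a\<close>: multiplication by \<open>a\<close> embeds the quotient by \<open>?I\<close>
    into the quotient by \<open>?IN\<close>.\<close>
  have mult_a: "a * g \<in> ?IN \<longleftrightarrow> g \<in> ?I" for g
  proof
    assume "g \<in> ?I"
    then obtain k where k: "g - k * f \<in> ?K" unfolding ideal.span_insert by blast
    have "a * (g - k * f) - k * (x ^ (M + 2) - a * f) \<in> ?K"
      by (rule span_simps(2)[OF span_simps(3)[OF k] span_simps(3)[OF a]])
    then have "a * (g - k * f) - k * (x ^ (M + 2) - a * f) + k * x ^ (M + 2) \<in> ?IN"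
      by (rule span_simps(1)[OF subsetD[OF KIN] xIN])
    then show "a * g \<in> ?IN" by (simp add: algebra_simps)
  next
    assume "a * g \<in> ?IN"
    then obtain k where k: "a * g - k * x ^ (M + 2) \<in> ?K" unfolding ideal.span_insert by blast
    have "(a * g - k * x ^ (M + 2)) + k * (x ^ (M + 2) - a * f) \<in> ?K"
      by (rule span_simps(1)[OF k span_simps(3)[OF a]])
    then have "a * (g - k * f) \<in> ?K" by (simp add: algebra_simps)
    then have "g - k * f \<in> ?K" by (rule a_nzd)
    then show "g \<in> ?I" unfolding ideal.span_insert by blast
  qed
  have "1 \<notin> ?I" by (rule one_notin_span) (use S f(1) in \<open>auto intro: exI[of _ 2]\<close>)
  then have "a * 1 \<notin> ?IN" by (simp only: mult_a not_False_eq_True)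
  then obtain s0 where s0: "a * s0 - sN \<in> ?IN" using gorN by force
  \<comment> \<open>The degree is that of \<open>sN\<close>, which is \<open>M + 1 + e\<close>,
    minus the degree \<open>M\<close> of \<open>a\<close>.\<close>
  define s' where "s' = hcomp (e + 1) s0"
  have "hcomp (M + 1 + e) (s0 * a - sN) \<in> ?IN"
    by (rule hcomp_span[OF homN]) (use s0 in \<open>simp_all add: mult.commute\<close>)
  then have s': "a * s' - sN \<in> ?IN"
    using sN by (simp add: hcomp_diff hcomp_of_forms hcomp_mult_forms[OF a_form] s'_def mult.commute[of a]
        del: power_Suc)
  show ?thesis
    unfolding gorenstein_def
  proof (intro bexI conjI allI impI)
    show "s' \<in> forms (e + 1)" unfolding s'_def by (rule hcomp_forms)
    show "s' \<notin> ?I"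
    proof
      assume "s' \<in> ?I"
      then have "a * s' - (a * s' - sN) \<in> ?IN" by (intro span_simps(2)[OF _ s']) (simp only: mult_a)
      then show False using sN_notin by simp
    qed
    fix g assume "g \<notin> ?I"
    then obtain h where h: "a * g * h - sN \<in> ?IN" using gorN mult_a by blast
    have "(a * g * h - sN) - (a * s' - sN) \<in> ?IN" by (rule span_simps(2)[OF h s'])
    then have "a * (g * h - s') \<in> ?IN" by (simp add: algebra_simps)
    then show "\<exists>h. g * h - s' \<in> ?I" using mult_a by blast
  qed
qed

subsection \<open>Generic linear combinations\<close>

lemma differentiable_prod:
  fixes g :: "'i \<Rightarrow> 'a::real_normed_vector \<Rightarrow> complex"
  assumes "\<And>j. j \<in> S \<Longrightarrow> g j differentiable (at x)"
  shows "(\<lambda>w. \<Prod>j\<in>S. g j w) differentiable (at x)"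
  using assms by (induction S rule: infinite_finite_induct) (auto intro: differentiable_mult)

lemma mv_eval_differentiable:
  fixes g :: "'a::real_normed_vector \<Rightarrow> 'v::finite \<Rightarrow> complex"
  assumes "\<And>j. (\<lambda>w. g w j) differentiable (at x)"
  shows "(\<lambda>w. mv_eval p (g w)) differentiable (at x)"
  unfolding mv_eval_superset[OF finite_keys order_refl] mon_eval_UNIV
  by (intro differentiable_sum finite_keys ballI differentiable_mult differentiable_const
      differentiable_prod differentiable_power assms)

lemma vec_nth_differentiable [simp]:
  "(\<lambda>w :: complex ^ 'n::finite. w $ i) differentiable (at x)"
  by (rule bounded_linear_imp_differentiable) (rule bounded_linear_vec_nth)

lemma differentiable_vec:
  fixes f :: "'a::real_normed_vector \<Rightarrow> complex ^ 'n::finite"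
  assumes "\<And>i. (\<lambda>w. f w $ i) differentiable (at x)"
  shows "f differentiable (at x)"
proof (subst differentiable_componentwise_within, intro ballI)
  fix b :: "complex ^ 'n" assume "b \<in> Basis"
  then obtain i u where "b = axis i u" by (auto simp: Basis_vec_def)
  then have "(\<lambda>w. f w \<bullet> b) = (\<lambda>w. f w $ i \<bullet> u)" by (auto simp: inner_axis)
  then show "(\<lambda>w. f w \<bullet> b) differentiable (at x)"
    using assms[of i] by (simp add: differentiable_inner)
qed

lemma negligible_coordinate_hyperplane: "negligible {w :: complex ^ 'n::finite. w $ j = 0}"
proof (rule negligible_subset)
  show "negligible {w :: complex ^ 'n. axis j 1 \<bullet> w = 0}"
    by (rule negligible_hyperplane) (simp add: axis_eq_0_iff)
qed (auto simp: inner_axis')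

lemma exists_not_in_negligible:
  assumes "negligible (N :: 'a::euclidean_space set)"
  obtains c where "c \<notin> N"
  using assms non_negligible_UNIV by (metis UNIV_eq_I)

text \<open>The image of a coordinate hyperplane is negligible, so some value \<open>c\<close> is avoided; projecting
  from \<open>c\<close> makes one quadric redundant on the hyperplane.\<close>

lemma generic_projection:
  fixes f :: "5 \<Rightarrow> poly5"
  assumes j: "j \<notin> B" and f: "\<And>i. i \<in> insert j B \<Longrightarrow> f i \<in> forms 2"
    and nz: "\<And>v :: complex ^ 5. v \<noteq> 0 \<Longrightarrow> (\<And>i. i \<notin> insert j B \<Longrightarrow> v $ i = 0) \<Longrightarrow>
      \<exists>i\<in>insert j B. mv_eval (f i) (($) v) \<noteq> 0"
  shows "\<exists>c. \<forall>v :: complex ^ 5. v \<noteq> 0 \<longrightarrow> (\<forall>i. i \<notin> B \<longrightarrow> v $ i = 0) \<longrightarrow>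
      (\<exists>i\<in>B. mv_eval (f i - mv_const (c i) * f j) (($) v) \<noteq> 0)"
proof -
  define cut :: "complex ^ 5 \<Rightarrow> 5 \<Rightarrow> complex" where "cut w i = (if i \<in> B then w $ i else 0)" for w i
  \<comment> \<open>The coordinates outside \<open>insert j B\<close> are carried along so that
    \<psi> maps the five-dimensional space to itself; only then is the image of a hyperplane
    negligible.\<close>
  define \<psi> :: "complex ^ 5 \<Rightarrow> complex ^ 5"
    where "\<psi> w = (\<chi> i. if i \<in> insert j B then mv_eval (f i) (cut w) else w $ i)" for w
  have cut: "(\<lambda>w. cut w i) differentiable (at x)" for i x
    by (cases "i \<in> B") (simp_all add: cut_def)
  have "\<psi> differentiable (at x)" for x
  proof (rule differentiable_vec)
    show "(\<lambda>w. \<psi> w $ i) differentiable (at x)" for i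
      by (cases "i \<in> insert j B") (simp_all add: \<psi>_def mv_eval_differentiable[OF cut])
  qed
  then have "\<psi> differentiable_on {w. w $ j = 0}"
    by (intro differentiable_at_imp_differentiable_on) auto
  then have "negligible (\<psi> ` {w. w $ j = 0})"
    by (intro negligible_differentiable_image_negligible negligible_coordinate_hyperplane) auto
  then have "negligible (\<psi> ` {w. w $ j = 0} \<union> {w. w $ j = 0})"
    by (intro negligible_Un negligible_coordinate_hyperplane)
  then obtain c where c: "c \<notin> \<psi> ` {w. w $ j = 0}" "c $ j \<noteq> 0"
    by (rule exists_not_in_negligible) auto
  have "\<exists>i\<in>B. mv_eval (f i - mv_const (c $ i / c $ j) * f j) (($) v) \<noteq> 0"
    if v: "v \<noteq> 0" "\<forall>i. i \<notin> B \<longrightarrow> v $ i = 0" for v :: "complex ^ 5"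
  proof (rule ccontr)
    assume neg: "\<not> ?thesis"
    define \<sigma> where "\<sigma> = mv_eval (f j) (($) v) / c $ j"
    have fv: "mv_eval (f i) (($) v) = \<sigma> * c $ i" if "i \<in> insert j B" for i
      using that neg c(2) by (auto simp: \<sigma>_def)
    have "\<exists>i\<in>insert j B. mv_eval (f i) (($) v) \<noteq> 0" using nz[OF v(1)] v(2) by auto
    then have "\<sigma> \<noteq> 0" using fv by auto
    \<comment> \<open>Quadrics scale by the square, so passing from \<open>v\<close> to \<tau> times
      \<open>v\<close> turns the values \<sigma> times \<open>c\<close> into \<open>c\<close>
      itself.\<close>
    define \<tau> where "\<tau> = csqrt (1 / \<sigma>)"
    have \<tau>: "\<tau> ^ 2 * \<sigma> = 1" using \<open>\<sigma> \<noteq> 0\<close> by (simp add: \<tau>_def)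
    define w :: "complex ^ 5" where "w = (\<chi> i. if i \<in> B then \<tau> * v $ i else if i = j then 0 else c $ i)"
    have cut_w: "cut w = (\<lambda>i. \<tau> * v $ i)" using v(2) by (auto simp: cut_def w_def)
    have "mv_eval (f i) (cut w) = c $ i" if "i \<in> insert j B" for i
    proof -
      have "mv_eval (f i) (cut w) = \<tau> ^ 2 * mv_eval (f i) (($) v)"
        unfolding cut_w by (rule mv_eval_forms_scale[OF f[OF that]])
      also have "\<dots> = (\<tau> ^ 2 * \<sigma>) * c $ i" using fv[OF that] by simp
      finally show ?thesis using \<tau> by simp
    qed
    then have "\<psi> w = c" by (auto simp: \<psi>_def vec_eq_iff w_def)
    moreover have "w $ j = 0" using j by (simp add: w_def)
    ultimately show False using c(1) by blast
  qed
  then show ?thesis by (intro exI[of _ "\<lambda>i. c $ i / c $ j"]) blast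
qed

lemma span_vanish:
  assumes "p \<in> ideal.span S" "\<And>s. s \<in> S \<Longrightarrow> mv_eval s f = 0"
  shows "mv_eval p f = 0"
  using assms(1) by (induction rule: ideal.span_induct_alt) (auto simp: assms(2))

lemma ideal_span_insert_cong: "ideal.span S = ideal.span T \<Longrightarrow> ideal.span (insert x S) = ideal.span (insert x T)"
  by (simp add: ideal.span_insert)

text \<open>Starting from the variables, the coordinates indexed by \<open>B\<close> are exchanged one at a time for
  generic combinations of the quadrics.\<close>

lemma quadrics_exchange:
  fixes f :: "5 \<Rightarrow> poly5"
  assumes "\<And>i. i \<in> B \<Longrightarrow> f i \<in> forms 2"
    and "\<And>v :: complex ^ 5. v \<noteq> 0 \<Longrightarrow> (\<And>i. i \<notin> B \<Longrightarrow> v $ i = 0) \<Longrightarrow>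
      \<exists>i\<in>B. mv_eval (f i) (($) v) \<noteq> 0"
  shows "\<exists>t. (\<forall>i\<in>B. t i \<in> forms 2) \<and> (\<forall>i. i \<notin> B \<longrightarrow> t i = var i) \<and>
    ideal.span (t ` B) = ideal.span (f ` B) \<and>
    permutably_regular t \<and> gorenstein (ideal.span (range t)) (card B)"
proof -
  have "finite B" by simp
  then show ?thesis
    using assms
  proof (induction B arbitrary: f rule: finite_induct)
    case empty
    then show ?case using permutably_regular_var gorenstein_var by (intro exI[of _ var]) simp
  next
    case (insert j B)
    obtain c where c: "\<And>v :: complex ^ 5. v \<noteq> 0 \<Longrightarrow> (\<And>i. i \<notin> B \<Longrightarrow> v $ i = 0) \<Longrightarrow>
      \<exists>i\<in>B. mv_eval (f i - mv_const (c i) * f j) (($) v) \<noteq> 0"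
      using generic_projection[OF insert.hyps(2) insert.prems] by blast
    \<comment> \<open>Subtracting multiples of \<open>f j\<close> leaves the ideal unchanged once
      \<open>f j\<close> is put back as element \<open>j\<close>, and the \<open>f' i\<close>
      already have no common zero on the smaller coordinate subspace.\<close>
    define f' where "f' i = f i - mv_const (c i) * f j" for i
    have "\<exists>t. (\<forall>i\<in>B. t i \<in> forms 2) \<and> (\<forall>i. i \<notin> B \<longrightarrow> t i = var i) \<and>
        ideal.span (t ` B) = ideal.span (f' ` B) \<and>
        permutably_regular t \<and> gorenstein (ideal.span (range t)) (card B)"
    proof (rule insert.IH)
      show "f' i \<in> forms 2" if "i \<in> B" for i
        unfolding f'_def using that by (intro forms_diff forms_const_mult insert.prems(1)) auto
      show "\<exists>i\<in>B. mv_eval (f' i) (($) v) \<noteq> 0" if "v \<noteq> 0" "\<And>i. i \<notin> B \<Longrightarrow> v $ i = 0"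
        for v :: "complex ^ 5"
        unfolding f'_def by (rule c) (use that in auto)
    qed
    then obtain t where t: "\<And>i. i \<in> B \<Longrightarrow> t i \<in> forms 2" "\<And>i. i \<notin> B \<Longrightarrow> t i = var i"
        "ideal.span (t ` B) = ideal.span (f' ` B)"
      and reg: "permutably_regular t" and gor: "gorenstein (ideal.span (range t)) (card B)"
      by blast
    define t' where "t' = t(j := f j)"
    have t'_forms: "\<forall>i\<in>insert j B. t' i \<in> forms 2"
      using t(1) insert.prems(1) by (auto simp: t'_def)
    have t'_var: "\<forall>i. i \<notin> insert j B \<longrightarrow> t' i = var i" using t(2) by (auto simp: t'_def)
    have im: "t' ` insert j B = insert (f j) (t ` B)"
      using insert.hyps(2) by (auto simp: t'_def image_iff)
    have span_eq: "ideal.span (t' ` insert j B) = ideal.span (f ` insert j B)"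
    proof -
      have "ideal.span (t' ` insert j B) = ideal.span (insert (f j) (f' ` B))"
        unfolding im by (rule ideal_span_insert_cong) (rule t(3))
      also have "\<dots> = ideal.span (f ` insert j B)"
        unfolding ideal.span_eq
      proof (intro conjI subsetI)
        fix p assume "p \<in> insert (f j) (f' ` B)"
        then show "p \<in> ideal.span (f ` insert j B)"
          by (auto simp: f'_def intro!: ideal.span_diff ideal.span_scale intro: ideal.span_base)
      next
        fix p assume "p \<in> f ` insert j B"
        then consider "p = f j" | i where "i \<in> B" "p = f' i + mv_const (c i) * f j"
          by (auto simp: f'_def)
        then show "p \<in> ideal.span (insert (f j) (f' ` B))"
        proof cases
          case 2
          show ?thesis unfolding 2(2)
            by (rule ideal.span_add[OF ideal.span_base ideal.span_scale[OF ideal.span_base]])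
              (use 2(1) in auto)
        qed (auto intro: ideal.span_base)
      qed
      finally show ?thesis .
    qed
    have t'_deg: "\<exists>d>0. t' i \<in> forms d" for i
      using t'_forms t'_var forms_var[of i] by (cases "i \<in> insert j B") (metis zero_less_numeral zero_less_one)+
    have t_deg: "\<exists>d>0. t i \<in> forms d" for i
      using t(1,2) forms_var[of i] by (cases "i \<in> B") (metis zero_less_numeral zero_less_one)+
    have "\<exists>n. var j ^ n \<in> ideal.span (range t')"
    proof (rule projective_nullstellensatz)
      show "\<exists>e. s \<in> forms e" if "s \<in> range t'" for s using t'_deg that by blast
      fix v :: "complex ^ 5" assume "v \<noteq> 0"
      show "\<exists>s\<in>range t'. mv_eval s (($) v) \<noteq> 0"
      proof (rule ccontr)
        assume "\<not> ?thesis"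
        then have zero: "mv_eval (t' i) (($) v) = 0" for i by blast
        have "v $ i = 0" if "i \<notin> insert j B" for i
          using zero[of i] t'_var that by simp
        then obtain i where i: "i \<in> insert j B" "mv_eval (f i) (($) v) \<noteq> 0"
          using insert.prems(2)[OF \<open>v \<noteq> 0\<close>] by blast
        have "f i \<in> ideal.span (t' ` insert j B)"
          unfolding span_eq using i(1) by (intro ideal.span_base) blast
        then have "mv_eval (f i) (($) v) = 0" by (rule span_vanish) (use zero in blast)
        with i(2) show False by contradiction
      qed
    qed
    then obtain n where n: "var j ^ n \<in> ideal.span (range t')" by blast
    have tj: "t j = var j" using t(2) insert.hyps(2) by blast
    have "permutably_regular t'"
      unfolding t'_def by (rule permutably_regular_exchange[OF reg t_deg, of _ n])
        (use n in \<open>simp add: tj t'_def\<close>)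
    moreover have "gorenstein (ideal.span (range t')) (card (insert j B))"
    proof -
      have r: "range t = insert (var j) (t ` (- {j}))" "range t' = insert (f j) (t ` (- {j}))"
        using tj by (auto simp: t'_def image_iff) metis
      have "gorenstein (ideal.span (insert (f j) (t ` (- {j})))) (card B + 1)"
      proof (rule gorenstein_exchange)
        show "\<exists>d>0. s \<in> forms d" if "s \<in> t ` (- {j})" for s using t_deg that by blast
        show "var j \<in> forms 1" by (rule forms_var)
        show "u \<in> ideal.span (t ` (- {j}))" if "var j * u \<in> ideal.span (t ` (- {j}))" for u
          using reg that unfolding permutably_regular_def tj[symmetric] by blast
        show "f j \<in> forms 2" using insert.prems(1) by blast
        show "var j ^ n \<in> ideal.span (insert (f j) (t ` (- {j})))" using n by (simp only: r)
        show "gorenstein (ideal.span (insert (var j) (t ` (- {j})))) (card B)"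
          using gor by (simp only: r)
      qed
      then show ?thesis using insert.hyps by (simp only: r) simp
    qed
    ultimately show ?case using t'_forms t'_var span_eq by blast
  qed
qed

theorem quadrics_gorenstein:
  fixes f :: "5 \<Rightarrow> poly5"
  assumes "\<And>i. f i \<in> forms 2"
    and "\<And>v :: complex ^ 5. v \<noteq> 0 \<Longrightarrow> \<exists>i. mv_eval (f i) (($) v) \<noteq> 0"
  shows "gorenstein (ideal.span (range f)) 5"
  using quadrics_exchange[of UNIV f] assms by auto

subsection \<open>Polynomial functions and openness\<close>

definition poly_fun :: "(poly5 \<Rightarrow> complex) \<Rightarrow> bool" where
  "poly_fun \<phi> \<longleftrightarrow> (\<exists>p :: (5 \<Rightarrow>\<^sub>0 nat, complex) mvpoly. \<forall>Q. \<phi> Q = mv_eval p (lookup Q))"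

lemma poly_funI: "(\<And>Q. \<phi> Q = mv_eval p (lookup Q)) \<Longrightarrow> poly_fun \<phi>"
  unfolding poly_fun_def by blast

lemma poly_fun_const [simp]: "poly_fun (\<lambda>_. c)"
  by (rule poly_funI[of _ "mv_const c"]) simp

lemma poly_fun_lookup [simp]: "poly_fun (\<lambda>Q. lookup Q m)"
  by (rule poly_funI[of _ "var m"]) simp

lemma poly_fun_add: "poly_fun \<phi> \<Longrightarrow> poly_fun \<psi> \<Longrightarrow> poly_fun (\<lambda>Q. \<phi> Q + \<psi> Q)"
  unfolding poly_fun_def by (metis mv_eval_add)

lemma poly_fun_diff: "poly_fun \<phi> \<Longrightarrow> poly_fun \<psi> \<Longrightarrow> poly_fun (\<lambda>Q. \<phi> Q - \<psi> Q)"
  unfolding poly_fun_def by (metis mv_eval_diff)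

lemma poly_fun_mult: "poly_fun \<phi> \<Longrightarrow> poly_fun \<psi> \<Longrightarrow> poly_fun (\<lambda>Q. \<phi> Q * \<psi> Q)"
  unfolding poly_fun_def by (metis mv_eval_mult)

lemma poly_fun_sum: "(\<And>x. x \<in> S \<Longrightarrow> poly_fun (\<phi> x)) \<Longrightarrow> poly_fun (\<lambda>Q. \<Sum>x\<in>S. \<phi> x Q)"
  by (induction S rule: infinite_finite_induct) (auto intro: poly_fun_add)

definition poly_family :: "(poly5 \<Rightarrow> poly5) \<Rightarrow> bool" where
  "poly_family g \<longleftrightarrow> (\<forall>m. poly_fun (\<lambda>Q. lookup (g Q) m))"

lemma poly_family_const: "poly_family (\<lambda>_. p)"
  by (simp add: poly_family_def)

lemma poly_family_id: "poly_family (\<lambda>Q. Q)"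
  by (simp add: poly_family_def)

lemma poly_family_add: "poly_family g \<Longrightarrow> poly_family h \<Longrightarrow> poly_family (\<lambda>Q. g Q + h Q)"
  by (simp add: poly_family_def lookup_add poly_fun_add)

lemma poly_family_diff: "poly_family g \<Longrightarrow> poly_family h \<Longrightarrow> poly_family (\<lambda>Q. g Q - h Q)"
  by (simp add: poly_family_def lookup_minus poly_fun_diff)

lemma poly_family_pderiv: "poly_family g \<Longrightarrow> poly_family (\<lambda>Q. mv_pderiv i (g Q))"
  by (simp add: poly_family_def lookup_mv_pderiv poly_fun_mult)

lemma poly_family_mult:
  assumes "poly_family g"
  shows "poly_family (\<lambda>Q. p * g Q)"
proof (induction p rule: mv_induct)
  case (single n c)
  have "poly_fun (\<lambda>Q. lookup (single n c * g Q) m)" for m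
  proof (cases "\<exists>k. m = n + k")
    case True
    then obtain k where "m = n + k" by blast
    then show ?thesis
      using assms by (simp add: lookup_single_mult poly_family_def poly_fun_mult)
  next
    case False
    then show ?thesis by (simp add: lookup_single_mult_eq_0)
  qed
  then show ?case by (simp add: poly_family_def)
next
  case (add p q)
  then show ?case by (simp add: distrib_right poly_family_add)
qed

section \<open>Rank conditions and absence of common zeros\<close>

text \<open>Elimination of one column at a time: injectivity of a matrix with polynomial entries is an
  open condition.\<close>

lemma kernel_trivial_open:
  fixes A :: "poly5 \<Rightarrow> 'r \<Rightarrow> 'c \<Rightarrow> complex"
  assumes "finite C" and "\<And>r c. poly_fun (\<lambda>Q. A Q r c)"
    and "\<And>v. (\<And>r. r \<in> R \<Longrightarrow> (\<Sum>c\<in>C. A Q0 r c * v c) = 0) \<Longrightarrow> \<forall>c\<in>C. v c = 0"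
  shows "\<exists>\<phi>. poly_fun \<phi> \<and> \<phi> Q0 \<noteq> 0 \<and>
    (\<forall>Q. \<phi> Q \<noteq> 0 \<longrightarrow> (\<forall>v. (\<forall>r\<in>R. (\<Sum>c\<in>C. A Q r c * v c) = 0) \<longrightarrow> (\<forall>c\<in>C. v c = 0)))"
  using assms
proof (induction C arbitrary: A rule: finite_induct)
  case empty
  then show ?case by (intro exI[of _ "\<lambda>_. 1"]) simp
next
  case (insert d C)
  note fin = insert.hyps(1) and d = insert.hyps(2)
  have "\<exists>r\<in>R. A Q0 r d \<noteq> 0"
  proof (rule ccontr)
    assume neg: "\<not> ?thesis"
    have "\<forall>c\<in>insert d C. (if c = d then 1 else 0 :: complex) = 0"
      by (rule insert.prems(2)) (use neg fin d in \<open>auto intro!: sum.neutral\<close>)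
    then show False by simp
  qed
  then obtain r0 where r0: "r0 \<in> R" "A Q0 r0 d \<noteq> 0" by blast
  \<comment> \<open>Cross-multiplication with the pivot \<open>A Q r0 d\<close>: dividing by it
    would leave the polynomial functions.\<close>
  define B where "B Q r c = A Q r c * A Q r0 d - A Q r d * A Q r0 c" for Q r c
  have sum_B: "(\<Sum>c\<in>C. B Q r c * v c)
      = A Q r0 d * (\<Sum>c\<in>C. A Q r c * v c) - A Q r d * (\<Sum>c\<in>C. A Q r0 c * v c)" for Q r v
    unfolding B_def by (simp add: algebra_simps sum_subtractf sum_distrib_left)
  have "\<exists>\<phi>. poly_fun \<phi> \<and> \<phi> Q0 \<noteq> 0 \<and>
    (\<forall>Q. \<phi> Q \<noteq> 0 \<longrightarrow> (\<forall>v. (\<forall>r\<in>R. (\<Sum>c\<in>C. B Q r c * v c) = 0) \<longrightarrow> (\<forall>c\<in>C. v c = 0)))"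
  proof (rule insert.IH)
    show "poly_fun (\<lambda>Q. B Q r c)" for r c
      unfolding B_def by (intro poly_fun_diff poly_fun_mult insert.prems(1))
    fix v assume Bv: "\<And>r. r \<in> R \<Longrightarrow> (\<Sum>c\<in>C. B Q0 r c * v c) = 0"
    \<comment> \<open>A kernel vector of \<open>B Q0\<close> is extended by solving row
      \<open>r0\<close> for column \<open>d\<close>.\<close>
    define w where "w = v(d := - (\<Sum>c\<in>C. A Q0 r0 c * v c) / A Q0 r0 d)"
    have "\<forall>c\<in>insert d C. w c = 0"
    proof (rule insert.prems(2))
      fix r assume "r \<in> R"
      have "(\<Sum>c\<in>C. A Q0 r c * w c) = (\<Sum>c\<in>C. A Q0 r c * v c)"
        by (rule sum.cong) (use d in \<open>auto simp: w_def\<close>)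
      then have "(\<Sum>c\<in>insert d C. A Q0 r c * w c)
          = (\<Sum>c\<in>C. A Q0 r c * v c) - A Q0 r d * (\<Sum>c\<in>C. A Q0 r0 c * v c) / A Q0 r0 d"
        using fin d by (simp add: w_def)
      also have "\<dots> = (\<Sum>c\<in>C. B Q0 r c * v c) / A Q0 r0 d"
        using r0(2) unfolding sum_B by (simp add: field_simps)
      finally show "(\<Sum>c\<in>insert d C. A Q0 r c * w c) = 0" using Bv[OF \<open>r \<in> R\<close>] by simp
    qed
    then show "\<forall>c\<in>C. v c = 0" using d by (auto simp: w_def split: if_splits)
  qed
  then obtain \<phi> where \<phi>: "poly_fun \<phi>" "\<phi> Q0 \<noteq> 0"
    "\<And>Q v. \<phi> Q \<noteq> 0 \<Longrightarrow> \<forall>r\<in>R. (\<Sum>c\<in>C. B Q r c * v c) = 0 \<Longrightarrow> \<forall>c\<in>C. v c = 0"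
    by blast
  show ?case
  proof (intro exI[of _ "\<lambda>Q. \<phi> Q * A Q r0 d"] conjI allI impI)
    show "poly_fun (\<lambda>Q. \<phi> Q * A Q r0 d)" by (intro poly_fun_mult \<phi>(1) insert.prems(1))
    show "\<phi> Q0 * A Q0 r0 d \<noteq> 0" using \<phi>(2) r0(2) by simp
    fix Q v assume nz: "\<phi> Q * A Q r0 d \<noteq> 0"
      and Av: "\<forall>r\<in>R. (\<Sum>c\<in>insert d C. A Q r c * v c) = 0"
    have sumC: "(\<Sum>c\<in>C. A Q r c * v c) = - A Q r d * v d" if "r \<in> R" for r
      using Av that fin d by (simp add: eq_neg_iff_add_eq_0 add.commute)
    have "\<forall>r\<in>R. (\<Sum>c\<in>C. B Q r c * v c) = 0"
      unfolding sum_B using sumC r0(1) by simp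
    then have C0: "\<forall>c\<in>C. v c = 0" by (rule \<phi>(3)[rotated]) (use nz in auto)
    moreover have "v d = 0" using sumC[OF r0(1)] C0 nz by simp
    ultimately show "\<forall>c\<in>insert d C. v c = 0" by blast
  qed
qed

text \<open>Pigeonhole: exponents that all stay below the \<open>n i\<close> add up to less than the
  sum of the \<open>n i\<close>.\<close>

lemma monomials_in_span:
  assumes "\<And>i. var i ^ n i \<in> ideal.span S" and "edeg m = (\<Sum>i\<in>UNIV. n i)"
  shows "single m 1 \<in> ideal.span S"
proof -
  have "\<exists>i. n i \<le> lookup m i"
  proof (rule ccontr)
    assume "\<nexists>i. n i \<le> lookup m i"
    then have "edeg m < (\<Sum>i\<in>UNIV. n i)"
      unfolding edeg_def by (intro sum_strict_mono) (auto simp: not_le)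
    with assms(2) show False by simp
  qed
  then obtain i where "n i \<le> lookup m i" by blast
  then have "m = single i (n i) + (m - single i (n i))" by (rule exponent_split)
  then have "single m 1 = single (m - single i (n i)) 1 * (var i ^ n i :: poly5)"
    by (simp add: var_power mult_single add.commute)
  then show ?thesis using assms(1) by (simp add: ideal.span_scale)
qed

text \<open>By the Nullstellensatz the forms \<open>g Q0\<close> generate all forms of some degree \<open>N\<close>; this is a
  rank condition on the matrix of the multiples of the \<open>g Q\<close> in degree \<open>N\<close>.\<close>

lemma no_common_zero_open:
  assumes G: "\<And>g. g \<in> G \<Longrightarrow> poly_family g" "\<And>g. g \<in> G \<Longrightarrow> \<exists>d. \<forall>Q\<in>forms 2. g Q \<in> forms d"
    and Q0: "Q0 \<in> forms 2"
    and nz: "\<And>v :: complex ^ 5. v \<noteq> 0 \<Longrightarrow> \<exists>g\<in>G. mv_eval (g Q0) (($) v) \<noteq> 0"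
  shows "\<exists>\<phi>. poly_fun \<phi> \<and> \<phi> Q0 \<noteq> 0 \<and> (\<forall>Q\<in>forms 2. \<phi> Q \<noteq> 0 \<longrightarrow>
    (\<forall>v :: complex ^ 5. v \<noteq> 0 \<longrightarrow> (\<exists>g\<in>G. mv_eval (g Q) (($) v) \<noteq> 0)))"
proof -
  define S where "S = (\<lambda>g. g Q0) ` G"
  obtain d where d: "\<And>g Q. g \<in> G \<Longrightarrow> Q \<in> forms 2 \<Longrightarrow> g Q \<in> forms (d g)" using G(2) by metis
  have "\<exists>n. var i ^ n \<in> ideal.span S" for i
    by (rule projective_nullstellensatz) (use d Q0 nz in \<open>auto simp: S_def\<close>)
  then obtain n where n: "\<And>i. var i ^ n i \<in> ideal.span S" by metis
  define N where "N = (\<Sum>i\<in>UNIV. n i)"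
  define C where "C = {m :: 5 \<Rightarrow>\<^sub>0 nat. edeg m = N}"
  have fin: "finite C" unfolding C_def by (rule finite_edeg_eq)
  define R where "R = {(g, k :: 5 \<Rightarrow>\<^sub>0 nat). g \<in> G \<and> edeg k + d g = N}"
  \<comment> \<open>Rows are the monomial multiples of degree \<open>N\<close>, so a kernel vector
    is a functional on forms of degree \<open>N\<close> that kills them all. Indices outside
    \<open>R\<close> get zero rows, because \<open>kernel_trivial_open\<close> asks for polynomial
    entries at every index.\<close>
  define A where "A Q r m = (if r \<in> R then lookup (single (snd r) 1 * fst r Q) m else 0)"
    for Q r m
  have "\<exists>\<phi>. poly_fun \<phi> \<and> \<phi> Q0 \<noteq> 0 \<and>
    (\<forall>Q. \<phi> Q \<noteq> 0 \<longrightarrow> (\<forall>v. (\<forall>r\<in>R. (\<Sum>c\<in>C. A Q r c * v c) = 0) \<longrightarrow> (\<forall>c\<in>C. v c = 0)))"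
  proof (rule kernel_trivial_open[OF fin])
    show "poly_fun (\<lambda>Q. A Q r m)" for r m
    proof (cases "r \<in> R")
      case True
      then have "poly_family (fst r)" using G(1) by (auto simp: R_def)
      then have "poly_family (\<lambda>Q. single (snd r) 1 * fst r Q)" by (rule poly_family_mult)
      then show ?thesis using True by (simp add: A_def poly_family_def)
    qed (simp add: A_def)
    fix v assume ker: "\<And>r. r \<in> R \<Longrightarrow> (\<Sum>m\<in>C. A Q0 r m * v m) = 0"
    define L where "L p = (\<Sum>m\<in>C. lookup p m * v m)" for p :: poly5
    have L_add: "L (p + q) = L p + L q" for p q
      by (simp add: L_def lookup_add distrib_right sum.distrib)
    have L_mult: "L (c * g Q0) = 0" if "g \<in> G" for c g
    proof (induction c rule: mv_induct)
      case (single k a)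
      have eq: "single k a * g Q0 = mv_const a * (single k 1 * g Q0)"
        by (metis single_eq_const_mult mult.assoc)
      have "L (single k 1 * g Q0) = 0"
      proof (cases "edeg k + d g = N")
        case True
        then have "(g, k) \<in> R" using that by (simp add: R_def)
        from ker[OF this] this show ?thesis by (simp add: A_def L_def)
      next
        case False
        have "single k 1 * g Q0 \<in> forms (edeg k + d g)"
          by (rule forms_single_mult) (rule d[OF that Q0])
        then show ?thesis using False by (auto simp: L_def C_def forms_iff intro!: sum.neutral)
      qed
      then show ?case unfolding eq by (simp add: L_def mult.assoc flip: sum_distrib_left)
    qed (simp add: distrib_right L_add)
    have L0: "L p = 0" if "p \<in> ideal.span S" for p
      using that
    proof (induction rule: ideal.span_induct_alt)
      case base
      show ?case by (simp add: L_def)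
    next
      case (step c x y)
      then show ?case using L_mult by (auto simp: S_def L_add)
    qed
    show "\<forall>m\<in>C. v m = 0"
    proof
      fix m assume m: "m \<in> C"
      then have "single m 1 \<in> ideal.span S"
        by (intro monomials_in_span[OF n]) (simp add: C_def N_def)
      then have "L (single m 1) = 0" by (rule L0)
      moreover have "L (single m 1) = (\<Sum>k\<in>C. if k = m then v m else 0)"
        unfolding L_def by (rule sum.cong) (auto simp: lookup_single)
      ultimately show "v m = 0" using fin m by simp
    qed
  qed
  then obtain \<phi> where \<phi>: "poly_fun \<phi>" "\<phi> Q0 \<noteq> 0"
    "\<And>Q v. \<phi> Q \<noteq> 0 \<Longrightarrow> \<forall>r\<in>R. (\<Sum>c\<in>C. A Q r c * v c) = 0 \<Longrightarrow> \<forall>c\<in>C. v c = 0"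
    by blast
  have "\<exists>g\<in>G. mv_eval (g Q) (($) v) \<noteq> 0"
    if Q: "Q \<in> forms 2" "\<phi> Q \<noteq> 0" and v: "v \<noteq> 0" for Q and v :: "complex ^ 5"
  proof (rule ccontr)
    assume neg: "\<not> ?thesis"
    \<comment> \<open>Evaluation at a common zero is a functional that kills all rows. Hence every
      monomial of degree \<open>N\<close> vanishes at \<open>v\<close>, in particular the pure
      powers.\<close>
    have "\<forall>m\<in>C. mon_eval (($) v) m = 0"
    proof (rule \<phi>(3)[OF Q(2)], intro ballI)
      fix r assume r: "r \<in> R"
      then obtain g k where gk: "r = (g, k)" "g \<in> G" "edeg k + d g = N" by (auto simp: R_def)
      let ?p = "single k 1 * g Q"
      have "?p \<in> forms N" using forms_single_mult[OF d[OF gk(2) Q(1)]] gk(3) by metis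
      then have "keys ?p \<subseteq> C" by (auto simp: C_def forms_iff in_keys_iff)
      then have "mv_eval ?p (($) v) = (\<Sum>m\<in>C. A Q r m * mon_eval (($) v) m)"
        using r by (simp only: mv_eval_superset[OF fin] A_def gk(1) fst_conv snd_conv if_True)
      then show "(\<Sum>m\<in>C. A Q r m * mon_eval (($) v) m) = 0" using neg gk(2) by auto
    qed
    then have "mon_eval (($) v) (single i N) = 0" for i by (simp add: C_def del: mon_eval_single)
    then have "v $ i = 0" for i by simp
    then show False using v by (simp add: vec_eq_iff)
  qed
  with \<phi>(1,2) show ?thesis by blast
qed

lemma mv_eval_line: "\<exists>q. \<forall>s. mv_eval p (\<lambda>i. a i + s * b i :: complex) = poly q s"
proof (induction p rule: mv_induct)
  case (single m c)
  show ?case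
    by (rule exI[of _ "smult c (\<Prod>i\<in>keys m. [:a i, b i:] ^ lookup m i)"])
      (simp add: mon_eval_def poly_prod)
next
  case (add p q)
  then obtain p' q' where "\<forall>s. mv_eval p (\<lambda>i. a i + s * b i) = poly p' s"
    "\<forall>s. mv_eval q (\<lambda>i. a i + s * b i) = poly q' s" by blast
  then show ?case by (intro exI[of _ "p' + q'"]) simp
qed

text \<open>Irreducibility of the space of forms: on the line through \<open>Q1\<close> and
  \<open>Q2\<close> both functions become nonzero polynomials in one variable, and their product has
  finitely many roots.\<close>

lemma poly_fun_nonzero_common:
  assumes "poly_fun \<phi>" "poly_fun \<psi>" "Q1 \<in> forms d" "Q2 \<in> forms d" "\<phi> Q1 \<noteq> 0" "\<psi> Q2 \<noteq> 0"
  shows "\<exists>Q\<in>forms d. \<phi> Q \<noteq> 0 \<and> \<psi> Q \<noteq> 0"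
proof -
  define L where "L s = Q1 + mv_const s * (Q2 - Q1)" for s
  have line: "\<exists>q. \<forall>s. \<theta> (L s) = poly q s" if \<theta>: "poly_fun \<theta>" for \<theta>
  proof -
    obtain p where p: "\<And>Q. \<theta> Q = mv_eval p (lookup Q)" using \<theta> unfolding poly_fun_def by blast
    have "lookup (L s) = (\<lambda>m. lookup Q1 m + s * (lookup Q2 m - lookup Q1 m))" for s
      by (rule ext) (simp add: L_def lookup_add lookup_minus)
    then show ?thesis unfolding p using mv_eval_line by simp
  qed
  obtain p q where p: "\<And>s. \<phi> (L s) = poly p s" and q: "\<And>s. \<psi> (L s) = poly q s"
    using line[OF assms(1)] line[OF assms(2)] by blast
  have "poly p 0 \<noteq> 0" "poly q 1 \<noteq> 0" using assms(5,6) p[of 0] q[of 1] by (auto simp: L_def)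
  then have "p * q \<noteq> 0" by auto
  then have "finite {s. poly (p * q) s = 0}" by (rule poly_roots_finite)
  then obtain s where "poly (p * q) s \<noteq> 0"
    using infinite_UNIV_char_0[where 'a = complex] by (metis (mono_tags, lifting) UNIV_eq_I mem_Collect_eq)
  moreover have "L s \<in> forms d"
    unfolding L_def using assms(3,4) by (intro forms_add forms_const_mult forms_diff)
  ultimately show ?thesis using p q by (intro bexI[of _ "L s"]) auto
qed

subsection \<open>Diagonal quadrics\<close>

text \<open>The projection to a coordinate subspace, taken on all of \<open>complex ^ 5\<close> so
  that one Lebesgue measure serves every \<open>Z\<close>.\<close>

definition cut_off :: "5 set \<Rightarrow> complex ^ 5 \<Rightarrow> 5 \<Rightarrow> complex" where
  "cut_off Z w i = (if i \<in> Z then 0 else w $ i)"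

lemma cut_off_differentiable: "(\<lambda>w. cut_off Z w i) differentiable (at x)"
  by (cases "i \<in> Z") (simp_all add: cut_off_def)

text \<open>The zero set meets every line in the direction of a point \<open>a\<close> outside it in finitely many
  points, so it is negligible by Tonelli's theorem.\<close>

lemma negligible_zero_set:
  assumes F: "F \<in> forms d" and a: "mv_eval F (cut_off Z a) \<noteq> 0"
  shows "negligible {w. mv_eval F (cut_off Z w) = 0}"
proof -
  define T where "T = {w. mv_eval F (cut_off Z w) = 0}"
  have "continuous_on UNIV (\<lambda>w. mv_eval F (cut_off Z w))"
    by (intro differentiable_imp_continuous_on differentiable_at_imp_differentiable_on
        mv_eval_differentiable cut_off_differentiable)
  then have "closed T" unfolding T_def by (intro closed_Collect_eq continuous_intros)
  then have T: "T \<in> sets borel" by simp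
  have fin: "finite {s :: real. s *\<^sub>R a + w \<in> T}" for w
  proof -
    obtain q where q: "\<And>s. mv_eval F (\<lambda>i. cut_off Z w i + s * cut_off Z a i) = poly q s"
      using mv_eval_line by metis
    \<comment> \<open>Homogeneity exchanges the two points: the value at \<open>a + s w\<close> is
      \<open>s ^ d\<close> times \<open>q\<close> at \<open>1 / s\<close>. If \<open>q\<close> were
      zero, the value at \<open>a\<close>, reached for \<open>s = 0\<close>, would vanish
      too.\<close>
    have "q \<noteq> 0"
    proof
      assume "q = 0"
      obtain p where p: "\<And>s. mv_eval F (\<lambda>i. cut_off Z a i + s * cut_off Z w i) = poly p s"
        using mv_eval_line by metis
      have "poly p s = 0" if "s \<noteq> 0" for s
      proof -
        have "(\<lambda>i. cut_off Z a i + s * cut_off Z w i)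
            = (\<lambda>i. s * (cut_off Z w i + 1 / s * cut_off Z a i))"
          using that by (auto simp: field_simps)
        then have "poly p s = s ^ d * poly q (1 / s)"
          by (simp only: p[symmetric] q[symmetric] mv_eval_forms_scale[OF F])
        then show ?thesis using \<open>q = 0\<close> by simp
      qed
      then have "UNIV - {0} \<subseteq> {s. poly p s = 0}" by auto
      then have "infinite {s. poly p s = 0}"
        using infinite_UNIV_char_0[where 'a = complex] by (meson finite_Diff2 finite.intros finite_subset)
      then have "p = 0" using poly_roots_finite by blast
      then show False using p[of 0] a by simp
    qed
    then have "finite {s. poly q s = 0}" by (rule poly_roots_finite)
    then have "finite (complex_of_real -` {s. poly q s = 0})"
      by (rule finite_vimageI) (simp add: inj_of_real)
    moreover have "cut_off Z (s *\<^sub>R a + w) = (\<lambda>i. cut_off Z w i + of_real s * cut_off Z a i)" for s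
      by (rule ext) (simp add: cut_off_def scaleR_conv_of_real[symmetric])
    then have "{s. s *\<^sub>R a + w \<in> T} = complex_of_real -` {s. poly q s = 0}"
      by (auto simp: T_def q)
    ultimately show ?thesis by simp
  qed
  \<comment> \<open>With \<open>s\<close> confined to an interval of length 1, translation
    invariance makes the double integral equal to the measure of \<open>T\<close>; in the other
    order the inner integrals run over finite sets.\<close>
  let ?I = "\<lambda>s w. indicator {0..1} s * indicator T (s *\<^sub>R a + w) :: ennreal"
  have "(\<lambda>p :: real \<times> (complex ^ 5). fst p *\<^sub>R a + snd p) \<in> borel_measurable borel"
    by (intro borel_measurable_continuous_onI continuous_intros)
  then have "(\<lambda>p :: real \<times> (complex ^ 5). fst p *\<^sub>R a + snd p) \<in> borel_measurable (lborel \<Otimes>\<^sub>M lborel)"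
    by (simp add: lborel_prod)
  then have meas: "case_prod ?I \<in> borel_measurable (lborel \<Otimes>\<^sub>M lborel)"
    unfolding split_beta' using T by measurable
  have "(\<integral>\<^sup>+w. indicator T (s *\<^sub>R a + w) \<partial>lborel) = emeasure lborel T" for s
  proof -
    have "emeasure lborel T = (\<integral>\<^sup>+w. indicator T w \<partial>(distr lborel borel ((+) (s *\<^sub>R a))))"
      using T by (simp add: lborel_distr_plus)
    also have "\<dots> = (\<integral>\<^sup>+w. indicator T (s *\<^sub>R a + w) \<partial>lborel)"
      using T by (subst nn_integral_distr) auto
    finally show ?thesis by simp
  qed
  then have "(\<integral>\<^sup>+s. \<integral>\<^sup>+w. ?I s w \<partial>lborel \<partial>lborel)
      = (\<integral>\<^sup>+s. indicator {0..1} s * emeasure lborel T \<partial>(lborel :: real measure))"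
    using T by (intro nn_integral_cong) (simp add: nn_integral_cmult)
  also have "\<dots> = emeasure lborel T"
    by (simp add: nn_integral_multc)
  finally have "emeasure lborel T = (\<integral>\<^sup>+s. \<integral>\<^sup>+w. ?I s w \<partial>lborel \<partial>lborel)" ..
  also have "\<dots> = (\<integral>\<^sup>+w. \<integral>\<^sup>+s. ?I s w \<partial>lborel \<partial>lborel)"
    using lborel_pair.Fubini'[OF meas] by simp
  also have "\<dots> = (\<integral>\<^sup>+w. 0 \<partial>(lborel :: (complex ^ 5) measure))"
  proof (rule nn_integral_cong)
    fix w :: "complex ^ 5"
    have "(\<integral>\<^sup>+s. ?I s w \<partial>lborel) \<le> (\<integral>\<^sup>+s. indicator {s. s *\<^sub>R a + w \<in> T} s \<partial>lborel)"
      by (intro nn_integral_mono) (auto split: split_indicator)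
    also have "\<dots> = emeasure lborel {s. s *\<^sub>R a + w \<in> T}"
      using fin[of w] by (intro nn_integral_indicator) (simp add: borel_closed finite_imp_closed)
    also have "\<dots> = 0"
      by (rule emeasure_lborel_countable) (rule countable_finite[OF fin])
    finally show "(\<integral>\<^sup>+s. ?I s w \<partial>lborel) = 0" by simp
  qed
  finally have "emeasure lborel T = 0" by simp
  then have "T \<in> null_sets lebesgue" using T by (intro null_sets_completionI) auto
  then show ?thesis unfolding T_def by (simp add: negligible_iff_null_sets)
qed

definition diag_quadric :: "complex ^ 5 \<Rightarrow> poly5" where
  "diag_quadric c = (\<Sum>i\<in>UNIV. single (single i 2) (c $ i))"

lemma diag_quadric_forms: "diag_quadric c \<in> forms 2"
  unfolding diag_quadric_def by (intro forms_sum forms_single) simp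

lemma gradient_nth: "gradient p v $ i = mv_eval (mv_pderiv i p) (($) v)"
  by (simp add: gradient_def)

lemma mv_pderiv_0 [simp]: "mv_pderiv i 0 = 0"
  by (simp add: mv_pderiv_def)

lemma mv_pderiv_sum: "mv_pderiv i (sum g S) = (\<Sum>x\<in>S. mv_pderiv i (g x))"
  by (induction S rule: infinite_finite_induct) (auto simp: mv_pderiv_add)

lemma mv_pderiv_single: "mv_pderiv i (single m c) = single (m - single i 1) (of_nat (lookup m i) * c)"
  by (cases "c = 0") (auto simp: mv_pderiv_def)

lemma gradient_diag_quadric: "gradient (diag_quadric c) v $ j = 2 * c $ j * v $ j"
proof -
  have "mv_pderiv j (diag_quadric c) = (\<Sum>i\<in>UNIV. if i = j then single (single j 1) (2 * c $ j) else 0)"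
    unfolding diag_quadric_def mv_pderiv_sum
    by (rule sum.cong) (auto simp: mv_pderiv_single lookup_single single_diff[symmetric])
  then show ?thesis by (simp add: gradient_nth)
qed

text \<open>For a bad coefficient vector \<open>c\<close>, the coordinates of \<open>c\<close> outside the zero set \<open>Z\<close> of \<open>v\<close> are
  the quotients of the partial derivatives by the coordinates of a multiple of \<open>v\<close>. Since \<open>v\<close> lies
  on the cubic, the set of these \<open>c\<close> is negligible.\<close>

lemma exists_fano_K3_pair:
  assumes F: "F \<in> forms 3" "smooth_form F"
  shows "\<exists>Q\<in>forms 2. fano_K3_pair F Q"
proof -
  define D where "D i = mv_pderiv i F" for i
  have D: "D i \<in> forms 2" for i
    unfolding D_def using F(1) by (intro forms_mv_pderiv) (simp add: numeral_3_eq_3 numeral_2_eq_2)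
  define \<phi> :: "5 set \<Rightarrow> complex ^ 5 \<Rightarrow> complex ^ 5"
    where "\<phi> Z w = (\<chi> i. if i \<in> Z then w $ i else mv_eval (D i) (cut_off Z w) / w $ i)" for Z w
  define W where "W Z = {w. (\<forall>i. i \<notin> Z \<longrightarrow> w $ i \<noteq> 0) \<and> mv_eval F (cut_off Z w) = 0}" for Z
  \<comment> \<open>The coordinate subspaces on which \<open>F\<close> does not vanish identically;
    for the others \<open>W Z\<close> need not be negligible and a separate argument
    follows.\<close>
  define \<Z> where "\<Z> = {Z. \<exists>a. mv_eval F (cut_off Z a) \<noteq> 0}"
  define N where "N = (\<Union>i. {c :: complex ^ 5. c $ i = 0}) \<union> (\<Union>Z\<in>\<Z>. \<phi> Z ` W Z)"
  have "negligible (\<phi> Z ` W Z)" if "Z \<in> \<Z>" for Z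
  proof (rule negligible_differentiable_image_negligible)
    have "negligible {w. mv_eval F (cut_off Z w) = 0}"
      using that negligible_zero_set[OF F(1)] by (auto simp: \<Z>_def)
    then show "negligible (W Z)" by (rule negligible_subset) (auto simp: W_def)
    show "\<phi> Z differentiable_on W Z"
    proof (rule differentiable_at_imp_differentiable_on, rule differentiable_vec)
      fix w i assume "w \<in> W Z"
      then show "(\<lambda>w. \<phi> Z w $ i) differentiable (at w)"
        by (cases "i \<in> Z")
          (simp_all add: \<phi>_def W_def differentiable_divide mv_eval_differentiable cut_off_differentiable)
    qed
  qed simp
  then have "negligible N"
    unfolding N_def by (intro negligible_Un negligible_Union finite_imageI)
      (auto intro: negligible_coordinate_hyperplane)
  then obtain c where c: "c \<notin> N" by (rule exists_not_in_negligible)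
  then have c_nz: "c $ i \<noteq> 0" for i by (auto simp: N_def)
  have "a = 0 \<and> b = 0"
    if v: "v \<noteq> 0" "mv_eval F (($) v) = 0"
      and ab: "a *s gradient F v + b *s gradient (diag_quadric c) v = 0" for v a b
  proof (rule ccontr)
    assume "\<not> (a = 0 \<and> b = 0)"
    have grad: "gradient F v \<noteq> 0" using F(2) v(1) by (simp add: smooth_form_def)
    have comp: "a * mv_eval (D i) (($) v) + b * (2 * c $ i * v $ i) = 0" for i
      using arg_cong[OF ab, of "\<lambda>x. x $ i"]
      by (simp add: gradient_diag_quadric) (simp add: gradient_nth D_def)
    have "b \<noteq> 0"
    proof
      assume "b = 0"
      with comp \<open>\<not> (a = 0 \<and> b = 0)\<close> have "mv_eval (D i) (($) v) = 0" for i by auto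
      then show False using grad by (simp add: vec_eq_iff gradient_nth D_def)
    qed
    define t where "t = - a / (2 * b)"
    have ct: "c $ i * v $ i = t * mv_eval (D i) (($) v)" for i
      using comp[of i] \<open>b \<noteq> 0\<close> by (simp add: t_def field_simps eq_neg_iff_add_eq_0)
    obtain i0 where i0: "v $ i0 \<noteq> 0" using v(1) by (auto simp: vec_eq_iff)
    have "t \<noteq> 0" using ct[of i0] i0 c_nz[of i0] by auto
    define Z where "Z = {i. v $ i = 0}"
    \<comment> \<open>The coordinates in \<open>Z\<close>, where \<open>v\<close> gives no
      information, store those of \<open>c\<close>, so that \<open>\<phi> Z\<close> recovers all of
      \<open>c\<close> from \<open>w\<close>.\<close>
    define w :: "complex ^ 5" where "w = (\<chi> i. if i \<in> Z then c $ i else t * v $ i)"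
    have cut_w: "cut_off Z w = (\<lambda>i. t * v $ i)" by (auto simp: cut_off_def w_def Z_def)
    show False
    proof (cases "Z \<in> \<Z>")
      case True
      have "mv_eval F (cut_off Z w) = 0"
        by (simp add: cut_w mv_eval_forms_scale[OF F(1)] v(2))
      then have "w \<in> W Z"
        unfolding W_def using \<open>t \<noteq> 0\<close> by (simp add: w_def) (simp add: Z_def)
      moreover have "\<phi> Z w $ i = c $ i" for i
      proof (cases "i \<in> Z")
        case False
        then have "v $ i \<noteq> 0" by (simp add: Z_def)
        have "\<phi> Z w $ i = t ^ 2 * mv_eval (D i) (($) v) / (t * v $ i)"
          using False by (simp add: \<phi>_def cut_w mv_eval_forms_scale[OF D]) (simp add: w_def)
        also have "\<dots> = t * (c $ i * v $ i) / (t * v $ i)"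
          unfolding ct by (simp add: power2_eq_square)
        finally show ?thesis using \<open>t \<noteq> 0\<close> \<open>v $ i \<noteq> 0\<close> by simp
      qed (simp add: \<phi>_def w_def)
      then have "\<phi> Z w = c" by (simp add: vec_eq_iff)
      ultimately show False using c True unfolding N_def by blast
    next
      case False
      \<comment> \<open>\<open>F\<close> vanishes on the whole coordinate subspace through
        \<open>v\<close>. Direction \<open>i0\<close> lies in it, so this partial derivative is zero
        at \<open>v\<close>, contrary to \<open>ct\<close> at \<open>i0\<close>.\<close>
      have "mv_eval F ((($) v)(i0 := s)) = 0" for s
      proof -
        have "(($) v)(i0 := s) = cut_off Z (\<chi> i. if i = i0 then s else v $ i)"
          using i0 by (auto simp: cut_off_def Z_def)
        then show ?thesis using False by (simp add: \<Z>_def)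
      qed
      then have "((\<lambda>s. 0) has_field_derivative mv_eval (D i0) ((($) v)(i0 := v $ i0))) (at (v $ i0))"
        using mv_pderiv_has_derivative[of F "($) v" i0 "v $ i0"] by (simp add: D_def)
      then have "mv_eval (D i0) (($) v) = 0" using DERIV_unique[OF _ DERIV_const] by force
      then show False using ct[of i0] i0 c_nz[of i0] by simp
    qed
  qed
  then have "fano_K3_pair F (diag_quadric c)"
    using F diag_quadric_forms by (auto simp: fano_K3_pair_def)
  then show ?thesis using diag_quadric_forms by blast
qed

subsection \<open>The polar pairing\<close>

text \<open>The multi-index factorial: the polar pairing is diagonal in the monomials, with these
  weights.\<close>

definition efact :: "(5 \<Rightarrow>\<^sub>0 nat) \<Rightarrow> complex" where
  "efact m = (\<Prod>i\<in>UNIV. fact (lookup m i))"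

lemma efact_0 [simp]: "efact 0 = 1"
  by (simp add: efact_def)

lemma efact_nonzero [simp]: "efact m \<noteq> 0"
  by (simp add: efact_def)

lemma efact_add_single: "efact (m + single i 1) = of_nat (lookup m i + 1) * efact m"
proof -
  have "(\<Prod>k\<in>UNIV-{i}. fact (lookup (m + single i 1) k)) = (\<Prod>k\<in>UNIV-{i}. fact (lookup m k) :: complex)"
    by (rule prod.cong) (auto simp: lookup_add lookup_single)
  then show ?thesis
    unfolding efact_def by (subst (1 2) prod.remove[of _ i]) (simp_all add: lookup_add)
qed

text \<open>Coefficients weighted by factorials, as in divided powers, turn differentiation into a
  pure shift of the index.\<close>

lemma efact_lookup_pderiv:
  "efact m * lookup (mv_pderiv i p) m = efact (m + single i 1) * lookup p (m + single i 1)"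
  by (simp only: lookup_mv_pderiv efact_add_single mult_ac)

lemma efact_lookup_pderiv_funpow:
  "efact m * lookup ((mv_pderiv i ^^ k) p) m = efact (m + single i k) * lookup p (m + single i k)"
proof (induction k arbitrary: m)
  case (Suc k)
  have "m + single i 1 + single i k = m + single i (Suc k)"
    by (simp add: add.assoc flip: single_add)
  then show ?case using Suc[of "m + single i 1"] by (simp add: efact_lookup_pderiv del: One_nat_def)
qed simp

lemma UNIV_5: "(UNIV :: 5 set) = {0, 1, 2, 3, 4}"
proof -
  have "card {0, 1, 2, 3, 4 :: 5} = 5" by simp
  then show ?thesis by (intro card_subset_eq[symmetric]) auto
qed

lemma lookup_diff_monom: "lookup (diff_monom m p) 0 = efact m * lookup p m"
proof -
  have "single 0 (lookup m 0) + single 1 (lookup m 1) + single 2 (lookup m 2)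
      + single 3 (lookup m 3) + single 4 (lookup m 4) = (\<Sum>i\<in>UNIV. single i (lookup m i))"
    unfolding UNIV_5 by (simp add: add_ac)
  also have "\<dots> = m"
    by (rule poly_mapping_eqI) (simp add: lookup_sum lookup_single when_def)
  finally have m: "single 0 (lookup m 0) + single 1 (lookup m 1) + single 2 (lookup m 2)
      + single 3 (lookup m 3) + single 4 (lookup m 4) = m" .
  have "lookup (diff_monom m p) 0 = efact 0 * lookup (diff_monom m p) 0" by simp
  also have "\<dots> = efact m * lookup p m"
    unfolding diff_monom_def comp_apply efact_lookup_pderiv_funpow add_0 m ..
  finally show ?thesis .
qed

lemma polar_pairing_eq:
  assumes "finite S" "keys a \<subseteq> S"
  shows "polar_pairing b a = (\<Sum>m\<in>S. lookup a m * (efact m * lookup b m))"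
proof -
  have "polar_pairing b a = (\<Sum>m\<in>keys a. lookup a m * (efact m * lookup b m))"
    by (simp add: polar_pairing_def diff_op_def lookup_sum lookup_diff_monom)
  also have "\<dots> = (\<Sum>m\<in>S. lookup a m * (efact m * lookup b m))"
    by (rule sum.mono_neutral_left) (use assms in \<open>auto simp: in_keys_iff\<close>)
  finally show ?thesis .
qed

lemma polar_pairing_forms:
  assumes "a \<in> forms d"
  shows "polar_pairing b a = (\<Sum>m | edeg m = d. lookup a m * (efact m * lookup b m))"
  by (rule polar_pairing_eq) (use assms in \<open>auto simp: finite_edeg_eq forms_iff in_keys_iff\<close>)

lemma polar_pairing_add_left: "polar_pairing (b + b') a = polar_pairing b a + polar_pairing b' a"
  by (simp add: polar_pairing_eq[OF finite_keys order_refl] lookup_add algebra_simps sum.distrib)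

lemma polar_pairing_scale_left: "polar_pairing (mv_const c * b) a = c * polar_pairing b a"
  by (simp add: polar_pairing_eq[OF finite_keys order_refl] sum_distrib_left mult.left_commute[of _ c])

lemma polar_pairing_scale_right: "polar_pairing b (mv_const c * a) = c * polar_pairing b a"
proof -
  have "keys (mv_const c * a) \<subseteq> keys a" by (auto simp: in_keys_iff)
  then show ?thesis
    by (simp add: polar_pairing_eq[of "keys a"] sum_distrib_left mult.assoc)
qed

lemma polar_pairing_monomial:
  assumes "a \<in> forms 3" "edeg m = 3"
  shows "polar_pairing (single m 1) a = efact m * lookup a m"
proof -
  have "polar_pairing (single m 1) a = (\<Sum>k | edeg k = 3. if k = m then efact m * lookup a m else 0)"
    unfolding polar_pairing_forms[OF assms(1)]
    by (rule sum.cong) (auto simp: lookup_single)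
  then show ?thesis using assms(2) by (simp add: finite_edeg_eq)
qed

lemma forms_expand:
  assumes "p \<in> forms d"
  shows "p = (\<Sum>m | edeg m = d. mv_const (lookup p m) * single m 1)"
proof (rule poly_mapping_eqI)
  fix k
  have "lookup (\<Sum>m | edeg m = d. mv_const (lookup p m) * single m 1) k
      = (\<Sum>m | edeg m = d. if m = k then lookup p k else 0)"
    unfolding lookup_sum by (rule sum.cong) (auto simp: lookup_single when_def)
  then show "lookup p k = lookup (\<Sum>m | edeg m = d. mv_const (lookup p m) * single m 1) k"
    using assms by (auto simp: finite_edeg_eq forms_iff)
qed

text \<open>Polarity to all \<open>a q\<close> means that the third derivatives of \<open>C\<close> with one direction \<open>a\<close> vanish; two
  applications of Euler's identity then make the gradient of \<open>C\<close> vanish at \<open>a\<close>.\<close>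

lemma singular_point_of_polar:
  assumes C: "C \<in> forms 3" and a: "a \<in> forms 1" "a \<noteq> 0"
    and polar: "\<And>q. q \<in> forms 2 \<Longrightarrow> polar_pairing (a * q) C = 0"
  shows "\<not> smooth_form C"
proof -
  define v :: "complex ^ 5" where "v = (\<chi> i. lookup a (single i 1))"
  have deg1: "{m :: 5 \<Rightarrow>\<^sub>0 nat. edeg m = 1} = range (\<lambda>i. single i 1)"
  proof (intro equalityI subsetI)
    fix m :: "5 \<Rightarrow>\<^sub>0 nat" assume "m \<in> {m. edeg m = 1}"
    then have m: "edeg m = 1" by simp
    then obtain i where "lookup m i \<noteq> 0" by (metis edeg_eq_0 lookup_zero poly_mapping_eqI zero_neq_one)
    then have eq: "m = single i 1 + (m - single i 1)" by (intro exponent_split) simp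
    then have "edeg m = 1 + edeg (m - single i 1)" by (metis edeg_add edeg_single)
    then have "m - single i 1 = 0" using m by simp
    with eq show "m \<in> range (\<lambda>i. single i 1)" by (metis add.right_neutral rangeI)
  qed auto
  have a_eq: "a = (\<Sum>i\<in>UNIV. mv_const (v $ i) * single (single i 1) 1)"
  proof -
    have "a = (\<Sum>m\<in>range (\<lambda>i. single i 1). mv_const (lookup a m) * single m 1)"
      using forms_expand[OF a(1)] by (simp only: deg1)
    also have "\<dots> = (\<Sum>i\<in>UNIV. mv_const (v $ i) * single (single i 1) 1)"
      by (subst sum.reindex) (auto simp: v_def inj_on_def dest: arg_cong[of _ _ keys])
    finally show ?thesis .
  qed
  have "v \<noteq> 0"
  proof
    assume "v = 0"
    then show False using a_eq a(2) by simp
  qed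
  \<comment> \<open>The weighted coefficients of \<open>C\<close> are its third derivatives; testing
    on the monomials \<open>q = single n 1\<close> contracts them with \<open>v\<close>.\<close>
  have third: "(\<Sum>i\<in>UNIV. v $ i * (efact (single i 1 + n) * lookup C (single i 1 + n))) = 0"
    if n: "edeg n = 2" for n
  proof -
    have "a * single n 1 = (\<Sum>i\<in>UNIV. mv_const (v $ i) * single (single i 1 + n) 1)"
      by (subst a_eq) (simp add: sum_distrib_right mult.assoc mult_single)
    then have "polar_pairing (a * single n 1) C
        = (\<Sum>m | edeg m = 3. \<Sum>i\<in>UNIV. if m = single i 1 + n then v $ i * (efact m * lookup C m) else 0)"
      unfolding polar_pairing_forms[OF C]
      by (auto simp: lookup_sum lookup_single when_def sum_distrib_left intro!: sum.cong)
    also have "\<dots> = (\<Sum>i\<in>UNIV. \<Sum>m | edeg m = 3.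
        if m = single i 1 + n then v $ i * (efact m * lookup C m) else 0)"
      by (rule sum.swap)
    also have "\<dots> = (\<Sum>i\<in>UNIV. v $ i * (efact (single i 1 + n) * lookup C (single i 1 + n)))"
      using n by (simp add: finite_edeg_eq)
    finally show ?thesis using polar[OF forms_single[OF n]] by simp
  qed
  have "mv_eval (mv_pderiv k (mv_pderiv j C)) (($) v) = 0" for j k
  proof -
    let ?p = "mv_pderiv k (mv_pderiv j C)"
    have p: "?p \<in> forms 1"
      using C by (intro forms_mv_pderiv) (simp add: numeral_3_eq_3)
    have "mv_eval (mv_pderiv i ?p) (($) v)
        = efact (single i 1 + (single k 1 + single j 1)) * lookup C (single i 1 + (single k 1 + single j 1))" for i
    proof -
      have "mv_pderiv i ?p \<in> forms 0" by (rule forms_mv_pderiv) (use p in simp)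
      then have "mv_pderiv i ?p = mv_const (lookup (mv_pderiv i ?p) 0)"
        by (intro poly_mapping_eqI) (auto simp: forms_iff mv_const_def lookup_single when_def)
      then have "mv_eval (mv_pderiv i ?p) (($) v) = lookup (mv_pderiv i ?p) 0"
        by (metis mv_eval_simps(3))
      also have "\<dots> = efact 0 * lookup (mv_pderiv i ?p) 0" by simp
      also have "\<dots> = efact (single i 1 + single k 1 + single j 1) * lookup C (single i 1 + single k 1 + single j 1)"
        unfolding efact_lookup_pderiv add_0 ..
      finally show ?thesis by (simp only: add.assoc)
    qed
    then have "(\<Sum>i\<in>UNIV. v $ i * mv_eval (mv_pderiv i ?p) (($) v)) = 0"
      using third[of "single k 1 + single j 1"] by simp
    then show ?thesis using euler_identity[OF p, of "($) v"] by simp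
  qed
  then have "mv_eval (mv_pderiv j C) (($) v) = 0" for j
    using euler_identity[of "mv_pderiv j C" 2 "($) v"] C
    by (simp add: forms_mv_pderiv numeral_3_eq_3 numeral_2_eq_2)
  then have "gradient C v = 0" by (simp add: vec_eq_iff gradient_nth)
  with \<open>v \<noteq> 0\<close> show ?thesis unfolding smooth_form_def by blast
qed

subsection \<open>The associated cubic\<close>

text \<open>\<open>lam\<close> identifies the quintics modulo the Jacobian ideal with the complex
  numbers. It is linear on all polynomials, so that additivity carries no degree conditions. The
  last assumption is the perfect pairing of cubics with quadrics, seen from the side of the
  cubics.\<close>

locale socle_functional =
  fixes F :: poly5 and lam :: "poly5 \<Rightarrow> complex"
  assumes functional_add: "lam (p + q) = lam p + lam q"
    and functional_scale: "lam (mv_const c * p) = c * lam p"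
    and functional_eq_0: "g \<in> forms 5 \<Longrightarrow> lam g = 0 \<longleftrightarrow> g \<in> jacobian_ideal F"
    and functional_nondegenerate:
      "b \<in> forms 3 \<Longrightarrow> b \<notin> jacobian_ideal F \<Longrightarrow> \<exists>Q\<in>forms 2. lam (b * Q) \<noteq> 0"

lemma socle_functional_exists:
  assumes F: "F \<in> forms 3" "smooth_form F"
  shows "\<exists>lam. socle_functional F lam"
proof -
  let ?J = "jacobian_ideal F"
  note Jsimps = subspace_ideal_simps[OF ideal.subspace_span[of "range (\<lambda>i. mv_pderiv i F)"],
      folded jacobian_ideal_def]
  have D: "mv_pderiv i F \<in> forms 2" for i
    using F(1) by (intro forms_mv_pderiv) (simp add: numeral_3_eq_3 numeral_2_eq_2)
  have "\<exists>i. mv_eval (mv_pderiv i F) (($) v) \<noteq> 0" if "v \<noteq> 0" for v :: "complex ^ 5"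
    using F(2) that by (auto simp: smooth_form_def vec_eq_iff gradient_nth)
  then have "gorenstein ?J 5"
    unfolding jacobian_ideal_def by (intro quadrics_gorenstein D) auto
  then obtain s where s: "s \<in> forms 5" "s \<notin> ?J" "\<And>g. g \<notin> ?J \<Longrightarrow> \<exists>h. g * h - s \<in> ?J"
    unfolding gorenstein_def by blast
  have comp: "hcomp d p \<in> ?J" if "p \<in> ?J" for d p
    using that D hcomp_span[of "range (\<lambda>i. mv_pderiv i F)"] unfolding jacobian_ideal_def by blast
  \<comment> \<open>Taking the component of degree 5 replaces the cofactor by a form of the
    complementary degree.\<close>
  have mult: "\<exists>h\<in>forms (5 - d). g * h - s \<in> ?J"
    if g: "g \<in> forms d" "g \<notin> ?J" "d \<le> 5" for g d
  proof -
    obtain h where "g * h - s \<in> ?J" using s(3) g(2) by blast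
    then have "hcomp 5 (h * g - s) \<in> ?J" by (intro comp) (simp add: mult.commute)
    then have "hcomp (5 - d) h * g - s \<in> ?J"
      using g(3) by (simp add: hcomp_diff hcomp_of_forms[OF s(1)] hcomp_mult_forms[OF g(1)])
    then have "g * hcomp (5 - d) h - s \<in> ?J" by (simp only: mult.commute)
    then show ?thesis using hcomp_forms by blast
  qed
  have scaleJ: "mv_const c * s \<in> ?J \<longleftrightarrow> c = 0" for c
  proof
    assume "mv_const c * s \<in> ?J"
    then have "mv_const (inverse c) * (mv_const c * s) \<in> ?J" by (rule Jsimps(3))
    moreover have "mv_const (inverse c) * (mv_const c * s) = mv_const (inverse c * c) * s"
      by (simp only: mv_const_simps mult.assoc)
    ultimately show "c = 0" using s(2) by (cases "c = 0") auto
  qed (simp add: Jsimps(6))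
  \<comment> \<open>In degree 5 the cofactor is a constant, nonzero because \<open>s\<close> is not
    in the ideal; inverting it writes the quintic as a multiple of \<open>s\<close>. By
    \<open>scaleJ\<close> the multiple is unique, and \<open>lam\<close> reads it off.\<close>
  have ex: "\<exists>c. hcomp 5 g - mv_const c * s \<in> ?J" for g
  proof (cases "hcomp 5 g \<in> ?J")
    case True
    then show ?thesis by (intro exI[of _ 0]) simp
  next
    case False
    then obtain h where h: "h \<in> forms 0" "hcomp 5 g * h - s \<in> ?J" using mult[OF hcomp_forms False] by auto
    define e where "e = lookup h 0"
    have h_eq: "h = mv_const e"
      using h(1) by (intro poly_mapping_eqI) (auto simp: e_def forms_iff mv_const_def lookup_single when_def)
    have "e \<noteq> 0" using h(2) s(2) Jsimps(5)[of "- s"] by (auto simp: h_eq)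
    have "mv_const (inverse e) * (hcomp 5 g * h - s) \<in> ?J" using h(2) by (rule Jsimps(3))
    moreover have "mv_const (inverse e) * (hcomp 5 g * h - s)
        = mv_const (inverse e * e) * hcomp 5 g - mv_const (inverse e) * s"
      unfolding h_eq mv_const_simps by (simp add: algebra_simps)
    ultimately show ?thesis using \<open>e \<noteq> 0\<close> by auto
  qed
  define lam where "lam g = (SOME c. hcomp 5 g - mv_const c * s \<in> ?J)" for g
  have lam: "hcomp 5 g - mv_const (lam g) * s \<in> ?J" for g
    unfolding lam_def by (rule someI_ex) (rule ex)
  have lam_eqI: "lam g = c" if "hcomp 5 g - mv_const c * s \<in> ?J" for g c
  proof -
    have "(hcomp 5 g - mv_const c * s) - (hcomp 5 g - mv_const (lam g) * s) \<in> ?J"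
      by (rule Jsimps(2)[OF that lam])
    then have "mv_const (lam g - c) * s \<in> ?J" by (simp add: algebra_simps)
    then show ?thesis by (simp only: scaleJ) simp
  qed
  have lam_0: "lam g = 0 \<longleftrightarrow> g \<in> ?J" if "g \<in> forms 5" for g
    using lam[of g] lam_eqI[of g 0] hcomp_of_forms[OF that, of 5] by auto
  have "socle_functional F lam"
  proof
    fix p q c
    have "(hcomp 5 p - mv_const (lam p) * s) + (hcomp 5 q - mv_const (lam q) * s) \<in> ?J"
      by (rule Jsimps(1)[OF lam lam])
    then show "lam (p + q) = lam p + lam q"
      by (intro lam_eqI) (simp add: hcomp_add algebra_simps)
    have "mv_const c * (hcomp 5 p - mv_const (lam p) * s) \<in> ?J"
      by (rule Jsimps(3)[OF lam])
    then show "lam (mv_const c * p) = c * lam p"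
      by (intro lam_eqI) (simp add: hcomp_const_mult right_diff_distrib mult.assoc)
  next
    show "lam g = 0 \<longleftrightarrow> g \<in> ?J" if "g \<in> forms 5" for g using that by (rule lam_0)
    fix b assume b: "b \<in> forms 3" "b \<notin> ?J"
    then obtain Q where Q: "Q \<in> forms 2" "b * Q - s \<in> ?J" using mult[OF b(1,2)] by auto
    have "b * Q \<notin> ?J"
    proof
      assume "b * Q \<in> ?J"
      then have "b * Q - (b * Q - s) \<in> ?J" by (rule Jsimps(2)[OF _ Q(2)])
      then show False using s(2) by simp
    qed
    moreover have "b * Q \<in> forms 5" using forms_mult[OF b(1) Q(1)] by simp
    ultimately show "\<exists>Q\<in>forms 2. lam (b * Q) \<noteq> 0" using lam_0 Q(1) by blast
  qed
  then show ?thesis by blast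
qed

context socle_functional
begin

lemma functional_0 [simp]: "lam 0 = 0"
  using functional_scale[of 0 0] by simp

lemma functional_sum: "lam (sum g S) = (\<Sum>x\<in>S. lam (g x))"
  by (induction S rule: infinite_finite_induct) (auto simp: functional_add)

text \<open>This is the cubic attached to \<open>Q\<close> in the overview; dividing by
  \<open>efact m\<close> cancels the weights of the polar pairing.\<close>

definition dual_cubic :: "poly5 \<Rightarrow> poly5" where
  "dual_cubic Q = (\<Sum>m | edeg m = 3. single m (lam (single m 1 * Q) / efact m))"

lemma lookup_dual_cubic:
  "lookup (dual_cubic Q) m = (if edeg m = 3 then lam (single m 1 * Q) / efact m else 0)"
proof -
  have "lookup (dual_cubic Q) m
      = (\<Sum>k | edeg k = 3. if k = m then lam (single m 1 * Q) / efact m else 0)"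
    unfolding dual_cubic_def lookup_sum by (rule sum.cong) (auto simp: lookup_single)
  then show ?thesis by (simp add: finite_edeg_eq)
qed

lemma dual_cubic_forms: "dual_cubic Q \<in> forms 3"
  by (simp add: forms_iff lookup_dual_cubic)

lemma polar_pairing_dual_cubic:
  assumes "b \<in> forms 3"
  shows "polar_pairing b (dual_cubic Q) = lam (b * Q)"
proof -
  have "lam (b * Q) = lam (\<Sum>m | edeg m = 3. mv_const (lookup b m) * (single m 1 * Q))"
    by (subst forms_expand[OF assms]) (simp add: sum_distrib_right mult.assoc)
  also have "\<dots> = (\<Sum>m | edeg m = 3. lookup b m * lam (single m 1 * Q))"
    by (simp add: functional_sum functional_scale)
  also have "\<dots> = polar_pairing b (dual_cubic Q)"
    unfolding polar_pairing_forms[OF dual_cubic_forms]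
    by (rule sum.cong) (auto simp: lookup_dual_cubic)
  finally show ?thesis ..
qed

lemma mem_colon_part_3:
  assumes "Q \<in> forms 2"
  shows "b \<in> colon_part F 3 Q \<longleftrightarrow> b \<in> forms 3 \<and> lam (b * Q) = 0"
proof -
  have "b * Q \<in> forms 5" if "b \<in> forms 3" using forms_mult[OF that assms] by simp
  then show ?thesis using functional_eq_0 by (auto simp: colon_part_def jacobian_part_def)
qed

text \<open>The pairing with \<open>a\<close> vanishes wherever the functional \<open>b\<close> |->
  \<open>lam (b * Q)\<close> does, so it is a multiple of that functional. If the latter is zero,
  both are zero.\<close>

lemma cubic_perp_colon_part:
  assumes Q: "Q \<in> forms 2"
  shows "cubic_perp (colon_part F 3 Q) = range (\<lambda>c. mv_const c * dual_cubic Q)"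
proof (intro equalityI subsetI)
  fix a assume "a \<in> range (\<lambda>c. mv_const c * dual_cubic Q)"
  then obtain c where "a = mv_const c * dual_cubic Q" by blast
  then show "a \<in> cubic_perp (colon_part F 3 Q)"
    by (auto simp: cubic_perp_def mem_colon_part_3[OF Q] polar_pairing_scale_right
        polar_pairing_dual_cubic forms_const_mult dual_cubic_forms)
next
  fix a assume "a \<in> cubic_perp (colon_part F 3 Q)"
  then have a: "a \<in> forms 3" "\<And>b. b \<in> forms 3 \<Longrightarrow> lam (b * Q) = 0 \<Longrightarrow> polar_pairing b a = 0"
    by (auto simp: cubic_perp_def mem_colon_part_3[OF Q])
  have "\<exists>c. \<forall>b\<in>forms 3. polar_pairing b a = c * lam (b * Q)"
  proof (cases "\<exists>b0\<in>forms 3. lam (b0 * Q) \<noteq> 0")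
    case True
    then obtain b0 where b0: "b0 \<in> forms 3" "lam (b0 * Q) \<noteq> 0" by blast
    define r where "r b = lam (b * Q) / lam (b0 * Q)" for b
    have "polar_pairing b a = polar_pairing b0 a / lam (b0 * Q) * lam (b * Q)" if b: "b \<in> forms 3" for b
    proof -
      let ?b = "b + mv_const (- r b) * b0"
      have "lam (?b * Q) = lam (b * Q) + - r b * lam (b0 * Q)"
        by (simp only: distrib_right functional_add mult.assoc functional_scale)
      then have "lam (?b * Q) = 0" using b0(2) by (simp add: r_def)
      then have "polar_pairing ?b a = 0"
        using a(2) b b0(1) forms_add forms_const_mult by blast
      then have "polar_pairing b a = r b * polar_pairing b0 a"
        unfolding polar_pairing_add_left polar_pairing_scale_left by simp
      then show ?thesis by (simp add: r_def)
    qed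
    then show ?thesis by blast
  qed (use a(2) in auto)
  then obtain c where c: "\<And>b. b \<in> forms 3 \<Longrightarrow> polar_pairing b a = c * lam (b * Q)" by blast
  have "a = mv_const c * dual_cubic Q"
  proof (rule poly_mapping_eqI)
    fix m
    show "lookup a m = lookup (mv_const c * dual_cubic Q) m"
    proof (cases "edeg m = 3")
      case True
      have "efact m * lookup a m = c * lam (single m 1 * Q)"
        using c[OF forms_single[OF True]] polar_pairing_monomial[OF a(1) True] by simp
      then show ?thesis using True by (simp add: lookup_dual_cubic field_simps)
    next
      case False
      then show ?thesis using a(1) by (auto simp: lookup_dual_cubic forms_iff)
    qed
  qed
  then show "a \<in> range (\<lambda>c. mv_const c * dual_cubic Q)" by blast
qed

lemma dual_cubic_add: "dual_cubic (p + q) = dual_cubic p + dual_cubic q"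
  by (rule poly_mapping_eqI)
    (simp add: lookup_dual_cubic lookup_add distrib_left functional_add add_divide_distrib)

lemma dual_cubic_scale: "dual_cubic (mv_const c * q) = mv_const c * dual_cubic q"
proof (rule poly_mapping_eqI)
  have "lam (single m 1 * (mv_const c * q)) = c * lam (single m 1 * q)" for m
    by (subst mult.left_commute) (rule functional_scale)
  then show "lookup (dual_cubic (mv_const c * q)) m = lookup (mv_const c * dual_cubic q) m" for m
    by (simp add: lookup_dual_cubic)
qed

text \<open>A form orthogonal to all the cubics \<open>dual_cubic Q\<close> lies in the Jacobian ideal, so these cubics
  exhaust the orthogonal complement of its cubic part.\<close>

lemma cubic_perp_jacobian_part:
  assumes G: "G \<in> cubic_perp (jacobian_part F 3)"
  shows "\<exists>Q\<in>forms 2. dual_cubic Q = G"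
proof (rule ccontr)
  assume neg: "\<not> ?thesis"
  define U where "U = dual_cubic ` forms 2"
  have "pvs.subspace U"
    unfolding pvs.subspace_def
  proof (intro conjI ballI allI)
    show "0 \<in> U" using dual_cubic_scale[of 0 0] forms_0[of 2] by (force simp: U_def)
    fix x y c assume x: "x \<in> U"
    show "mv_const c * x \<in> U"
      using x dual_cubic_scale[symmetric] forms_const_mult by (auto simp: U_def)
    assume "y \<in> U"
    with x show "x + y \<in> U"
      using dual_cubic_add[symmetric] forms_add by (auto simp: U_def)
  qed
  moreover obtain B where B: "B \<subseteq> U" "pvs.independent B" "U \<subseteq> pvs.span B"
    by (rule pvs.maximal_independent_subset)
  ultimately have span: "pvs.span B = U" using pvs.span_minimal[OF B(1)] by blast
  have "G \<notin> U" using neg by (auto simp: U_def)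
  then have ind: "pvs.independent (insert G B)" using B(2) span by (simp add: pvs.independent_insertI)
  interpret vp: vector_space_pair "\<lambda>c (p :: poly5). mv_const c * p" "(*) :: complex \<Rightarrow> complex \<Rightarrow> complex"
    by unfold_locales (simp_all add: algebra_simps)
  \<comment> \<open>A functional that separates \<open>G\<close> from the subspace \<open>U\<close>;
    on cubics it is the pairing with the form \<open>b\<close> below, again by division by the
    weights.\<close>
  obtain \<phi> where lin: "Vector_Spaces.linear (\<lambda>c (p :: poly5). mv_const c * p) (*) \<phi>"
    and \<phi>: "\<forall>x\<in>insert G B. \<phi> x = (if x = G then 1 else 0 :: complex)"
    using vp.linear_independent_extend[OF ind, of "\<lambda>x. if x = G then 1 else 0"] by blast
  interpret \<phi>: Vector_Spaces.linear "\<lambda>c (p :: poly5). mv_const c * p" "(*) :: complex \<Rightarrow> complex \<Rightarrow> complex" \<phi>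
    by (rule lin)
  have "\<phi> x = 0" if "x \<in> B" for x using \<phi> that B(1) \<open>G \<notin> U\<close> by auto
  then have \<phi>U: "\<phi> x = 0" if "x \<in> U" for x
    using that \<phi>.eq_0_on_span[of B x] unfolding span by blast
  define b where "b = (\<Sum>m | edeg m = 3. single m (\<phi> (single m 1) / efact m))"
  have b: "b \<in> forms 3" unfolding b_def by (intro forms_sum forms_single) simp
  have lookup_b: "lookup b m = \<phi> (single m 1) / efact m" if "edeg m = 3" for m
  proof -
    have "lookup b m = (\<Sum>k | edeg k = 3. if k = m then \<phi> (single m 1) / efact m else 0)"
      unfolding b_def lookup_sum by (rule sum.cong) (auto simp: lookup_single)
    then show ?thesis using that by (simp add: finite_edeg_eq)
  qed
  have pair: "polar_pairing b a = \<phi> a" if a: "a \<in> forms 3" for a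
  proof -
    have "\<phi> a = (\<Sum>m | edeg m = 3. lookup a m * \<phi> (single m 1))"
      by (subst forms_expand[OF a]) (simp add: \<phi>.sum \<phi>.scale)
    also have "\<dots> = polar_pairing b a"
      unfolding polar_pairing_forms[OF a] by (rule sum.cong) (auto simp: lookup_b)
    finally show ?thesis ..
  qed
  have "lam (b * Q) = 0" if "Q \<in> forms 2" for Q
    using \<phi>U[of "dual_cubic Q"] that
    by (simp add: U_def pair[OF dual_cubic_forms, symmetric] polar_pairing_dual_cubic[OF b])
  then have "b \<in> jacobian_ideal F" using functional_nondegenerate[OF b] by blast
  then have "polar_pairing b G = 0" using G b by (auto simp: cubic_perp_def jacobian_part_def)
  moreover have "G \<in> forms 3" using G by (simp add: cubic_perp_def)
  ultimately show False using pair \<phi> by simp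
qed

lemma associated_cubic_iff:
  assumes "Q \<in> forms 2"
  shows "associated_cubic F Q C \<longleftrightarrow>
    range (\<lambda>c. mv_const c * C) = range (\<lambda>c. mv_const c * dual_cubic Q)"
  by (simp add: associated_cubic_def cubic_perp_colon_part[OF assms])

lemma associated_cubic_smooth:
  assumes Q: "Q \<in> forms 2" and smooth: "smooth_form (dual_cubic Q)" and C: "associated_cubic F Q C"
  shows "smooth_form C"
proof -
  have "mv_const 1 * dual_cubic Q \<in> range (\<lambda>c. mv_const c * C)"
    using C unfolding associated_cubic_iff[OF Q] by blast
  then obtain c where c: "dual_cubic Q = mv_const c * C" by auto
  have "gradient (dual_cubic Q) v = c *s gradient C v" for v
    by (simp add: vec_eq_iff gradient_nth c mv_pderiv_const_mult)
  then show ?thesis using smooth by (auto simp: smooth_form_def c)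
qed

lemma colon_part_1:
  assumes Q: "Q \<in> forms 2" and smooth: "smooth_form (dual_cubic Q)"
  shows "colon_part F 1 Q = {0}"
proof (intro equalityI subsetI)
  fix a assume "a \<in> colon_part F 1 Q"
  then have a: "a \<in> forms 1" "a * Q \<in> jacobian_ideal F"
    by (auto simp: colon_part_def jacobian_part_def)
  have "polar_pairing (a * q) (dual_cubic Q) = 0" if q: "q \<in> forms 2" for q
  proof -
    have aq: "a * q \<in> forms 3" using forms_mult[OF a(1) q] by (simp add: numeral_3_eq_3)
    then have "a * q * Q \<in> forms 5" using forms_mult[OF _ Q] by fastforce
    moreover have "q * (a * Q) \<in> jacobian_ideal F"
      using a(2) unfolding jacobian_ideal_def by (rule ideal.span_scale)
    then have "a * q * Q \<in> jacobian_ideal F" by (simp add: mult_ac)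
    ultimately show ?thesis by (simp add: polar_pairing_dual_cubic[OF aq] functional_eq_0)
  qed
  then show "a \<in> {0}"
    using singular_point_of_polar[OF dual_cubic_forms a(1)] smooth by blast
next
  fix a :: poly5 assume "a \<in> {0}"
  then show "a \<in> colon_part F 1 Q"
    by (simp add: colon_part_def jacobian_part_def jacobian_ideal_def ideal.span_zero)
qed

text \<open>A polynomial function may involve only finitely many coefficients, and the assumptions
  on \<open>lam\<close> do not ensure this for arbitrary \<open>Q\<close>. Passing to the quadratic
  part leaves a finite sum and changes nothing on \<open>forms 2\<close>.\<close>

lemma poly_family_dual_cubic: "poly_family (\<lambda>Q. dual_cubic (hcomp 2 Q))"
  unfolding poly_family_def
proof
  fix m
  have eq: "lam (single m 1 * hcomp 2 Q) = (\<Sum>n | edeg n = 2. lookup Q n * lam (single m 1 * single n 1))" for Q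
  proof -
    have "single m 1 * hcomp 2 Q
        = (\<Sum>n | edeg n = 2. mv_const (lookup (hcomp 2 Q) n) * (single m 1 * single n 1))"
      by (subst forms_expand[OF hcomp_forms]) (simp add: sum_distrib_left mult.left_commute)
    then show ?thesis
      by (simp add: functional_sum functional_scale lookup_hcomp)
  qed
  have "poly_fun (\<lambda>Q. (if edeg m = 3 then inverse (efact m) else 0) *
      (\<Sum>n | edeg n = 2. lookup Q n * lam (single m 1 * single n 1)))"
    by (intro poly_fun_mult poly_fun_sum) simp_all
  moreover have "lookup (dual_cubic (hcomp 2 Q)) m = (if edeg m = 3 then inverse (efact m) else 0) *
      (\<Sum>n | edeg n = 2. lookup Q n * lam (single m 1 * single n 1))" for Q
    by (simp add: lookup_dual_cubic eq divide_inverse mult.commute)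
  ultimately show "poly_fun (\<lambda>Q. lookup (dual_cubic (hcomp 2 Q)) m)" by simp
qed

lemma smooth_dual_cubic_open:
  assumes Q0: "Q0 \<in> forms 2" and smooth: "smooth_form (dual_cubic Q0)"
  shows "\<exists>\<phi>. poly_fun \<phi> \<and> \<phi> Q0 \<noteq> 0 \<and> (\<forall>Q\<in>forms 2. \<phi> Q \<noteq> 0 \<longrightarrow> smooth_form (dual_cubic Q))"
proof -
  define g where "g i Q = mv_pderiv i (dual_cubic (hcomp 2 Q))" for i Q
  have g: "g i Q = mv_pderiv i (dual_cubic Q)" if "Q \<in> forms 2" for i Q
    using hcomp_of_forms[OF that, of 2] by (simp add: g_def)
  have g_forms: "g i Q \<in> forms 2" for i Q
    unfolding g_def using dual_cubic_forms
    by (intro forms_mv_pderiv) (simp add: numeral_3_eq_3 numeral_2_eq_2)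
  have "\<exists>\<phi>. poly_fun \<phi> \<and> \<phi> Q0 \<noteq> 0 \<and> (\<forall>Q\<in>forms 2. \<phi> Q \<noteq> 0 \<longrightarrow>
    (\<forall>v :: complex ^ 5. v \<noteq> 0 \<longrightarrow> (\<exists>h\<in>range g. mv_eval (h Q) (($) v) \<noteq> 0)))"
  proof (rule no_common_zero_open[OF _ _ Q0])
    have "g i = (\<lambda>Q. mv_pderiv i (dual_cubic (hcomp 2 Q)))" for i
      by (rule ext) (rule g_def)
    then show "poly_family h" if "h \<in> range g" for h
      using that poly_family_pderiv[OF poly_family_dual_cubic] by auto
    show "\<exists>d. \<forall>Q\<in>forms 2. h Q \<in> forms d" if "h \<in> range g" for h
      using that g_forms by blast
    fix v :: "complex ^ 5" assume "v \<noteq> 0"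
    then have "gradient (dual_cubic Q0) v \<noteq> 0" using smooth by (simp add: smooth_form_def)
    then show "\<exists>h\<in>range g. mv_eval (h Q0) (($) v) \<noteq> 0"
      by (auto simp: vec_eq_iff gradient_nth g[OF Q0])
  qed
  then obtain \<phi> where \<phi>: "poly_fun \<phi>" "\<phi> Q0 \<noteq> 0"
    "\<And>Q v. Q \<in> forms 2 \<Longrightarrow> \<phi> Q \<noteq> 0 \<Longrightarrow> v \<noteq> 0 \<Longrightarrow> \<exists>h\<in>range g. mv_eval (h Q) (($) (v :: complex ^ 5)) \<noteq> 0"
    by blast
  have "smooth_form (dual_cubic Q)" if Q: "Q \<in> forms 2" "\<phi> Q \<noteq> 0" for Q
  proof -
    have grad: "gradient (dual_cubic Q) v \<noteq> 0" if "v \<noteq> 0" for v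
      using \<phi>(3)[OF Q that] by (auto simp: vec_eq_iff gradient_nth g[OF Q(1)])
    \<comment> \<open>The zero form has zero gradient everywhere, so any single nonzero point
      excludes it.\<close>
    moreover have "dual_cubic Q \<noteq> 0"
    proof
      assume "dual_cubic Q = 0"
      then have "gradient (dual_cubic Q) (axis 0 1) = 0" by (simp add: vec_eq_iff gradient_nth)
      with grad[of "axis 0 1"] show False by (simp add: axis_eq_0_iff)
    qed
    ultimately show ?thesis by (simp add: smooth_form_def)
  qed
  with \<phi>(1,2) show ?thesis by blast
qed

end

section \<open>Openness of the Fano-K3 condition, and the conclusion\<close>

lemma fano_K3_pair_open:
  assumes F: "F \<in> forms 3" "smooth_form F" and Q0: "fano_K3_pair F Q0"
  shows "\<exists>\<phi>. poly_fun \<phi> \<and> \<phi> Q0 \<noteq> 0 \<and> (\<forall>Q\<in>forms 2. \<phi> Q \<noteq> 0 \<longrightarrow> fano_K3_pair F Q)"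
proof -
  define D where "D i = mv_pderiv i F" for i
  \<comment> \<open>The 2 by 2 minors of the two gradients: a pair is Fano-K3 exactly if
    \<open>F\<close>, \<open>Q\<close> and these minors have no common zero, which is the kind of
    condition that \<open>no_common_zero_open\<close> handles.\<close>
  define minor where "minor r Q = D (fst r) * mv_pderiv (snd r) Q - D (snd r) * mv_pderiv (fst r) Q"
    for r and Q :: poly5
  define G where "G = insert (\<lambda>_. F) (insert (\<lambda>Q. Q) (range minor))"
  have D: "D i \<in> forms 2" for i
    unfolding D_def using F(1) by (intro forms_mv_pderiv) (simp add: numeral_3_eq_3 numeral_2_eq_2)
  have dQ: "mv_pderiv i Q \<in> forms 1" if "Q \<in> forms 2" for i Q
    using that by (intro forms_mv_pderiv) (simp add: numeral_2_eq_2)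
  have minor_forms: "minor r Q \<in> forms 3" if "Q \<in> forms 2" for r Q
    unfolding minor_def
    using forms_mult[OF D dQ[OF that]] by (intro forms_diff) simp_all
  have iff: "fano_K3_pair F Q \<longleftrightarrow>
      (\<forall>v :: complex ^ 5. v \<noteq> 0 \<longrightarrow> (\<exists>g\<in>G. mv_eval (g Q) (($) v) \<noteq> 0))" if Q: "Q \<in> forms 2" for Q
  proof -
    have ind: "(\<forall>a b. a *s gradient F v + b *s gradient Q v = 0 \<longrightarrow> a = 0 \<and> b = 0) \<longleftrightarrow>
        (\<exists>r. mv_eval (minor r Q) (($) v) \<noteq> 0)" if "v \<noteq> 0" for v
    proof -
      let ?d = "\<lambda>i. mv_eval (D i) (($) v)" and ?q = "\<lambda>i. mv_eval (mv_pderiv i Q) (($) v)"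
      have "gradient F v \<noteq> 0" using F(2) that by (simp add: smooth_form_def)
      then obtain i where i: "?d i \<noteq> 0" by (auto simp: vec_eq_iff gradient_nth D_def)
      have lin: "a *s gradient F v + b *s gradient Q v = 0 \<longleftrightarrow> (\<forall>j. a * ?d j + b * ?q j = 0)" for a b
        by (simp add: vec_eq_iff gradient_nth D_def)
      have minor: "mv_eval (minor r Q) (($) v) = ?d (fst r) * ?q (snd r) - ?d (snd r) * ?q (fst r)" for r
        by (simp add: minor_def)
      show ?thesis
      proof (intro iffI)
        assume *: "\<forall>a b. a *s gradient F v + b *s gradient Q v = 0 \<longrightarrow> a = 0 \<and> b = 0"
        show "\<exists>r. mv_eval (minor r Q) (($) v) \<noteq> 0"
        proof (rule ccontr)
          assume "\<not> ?thesis"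
          then have "?d i * ?q j - ?d j * ?q i = 0" for j using minor[of "(i, j)"] by simp
          \<comment> \<open>If all minors vanish, the coefficients \<open>?q i\<close> and
            \<open>- ?d i\<close> give a relation between the gradients, nontrivial by the choice of
            \<open>i\<close>.\<close>
          then have "\<forall>j. ?q i * ?d j + - ?d i * ?q j = 0" by (simp add: algebra_simps)
          with * lin have "- ?d i = 0" by blast
          with i show False by simp
        qed
      next
        assume "\<exists>r. mv_eval (minor r Q) (($) v) \<noteq> 0"
        then obtain k l where kl: "?d k * ?q l - ?d l * ?q k \<noteq> 0" by (auto simp: minor)
        show "\<forall>a b. a *s gradient F v + b *s gradient Q v = 0 \<longrightarrow> a = 0 \<and> b = 0"
        proof (intro allI impI)
          fix a b assume "a *s gradient F v + b *s gradient Q v = 0"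
          then have e: "a * ?d k + b * ?q k = 0" "a * ?d l + b * ?q l = 0" by (simp_all add: lin)
          have "a * (?d k * ?q l - ?d l * ?q k) = (a * ?d k + b * ?q k) * ?q l - (a * ?d l + b * ?q l) * ?q k"
            "b * (?d k * ?q l - ?d l * ?q k) = (a * ?d l + b * ?q l) * ?d k - (a * ?d k + b * ?q k) * ?d l"
            by (simp_all add: algebra_simps)
          then show "a = 0 \<and> b = 0" using e kl by simp
        qed
      qed
    qed
    show ?thesis
      using F Q ind by (auto simp: fano_K3_pair_def G_def)
  qed
  have "Q0 \<in> forms 2" using Q0 by (simp add: fano_K3_pair_def)
  have "\<exists>\<phi>. poly_fun \<phi> \<and> \<phi> Q0 \<noteq> 0 \<and> (\<forall>Q\<in>forms 2. \<phi> Q \<noteq> 0 \<longrightarrow>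
    (\<forall>v :: complex ^ 5. v \<noteq> 0 \<longrightarrow> (\<exists>g\<in>G. mv_eval (g Q) (($) v) \<noteq> 0)))"
  proof (rule no_common_zero_open[OF _ _ \<open>Q0 \<in> forms 2\<close>])
    have "poly_family (minor r)" for r
    proof -
      have "minor r = (\<lambda>Q. D (fst r) * mv_pderiv (snd r) Q - D (snd r) * mv_pderiv (fst r) Q)"
        by (rule ext) (rule minor_def)
      then show ?thesis
        by (simp only:) (intro poly_family_diff poly_family_mult poly_family_pderiv poly_family_id)
    qed
    then show "poly_family g" if "g \<in> G" for g
      using that by (auto simp: G_def poly_family_const poly_family_id)
    show "\<exists>d. \<forall>Q\<in>forms 2. g Q \<in> forms d" if "g \<in> G" for g
      using that F(1) minor_forms by (auto simp: G_def)
    show "\<exists>g\<in>G. mv_eval (g Q0) (($) v) \<noteq> 0" if "v \<noteq> 0" for v :: "complex ^ 5"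
      using Q0 that iff[OF \<open>Q0 \<in> forms 2\<close>] by blast
  qed
  then show ?thesis using iff by blast
qed

theorem corollary1p5:
  fixes F :: poly5
  assumes "F \<in> smooth_perp_cubics"
  shows "generic_form 2 (\<lambda>Q.
    fano_K3_pair F Q \<and>
    ((\<exists>C. associated_cubic F Q C) \<and> (\<forall>C. associated_cubic F Q C \<longrightarrow> smooth_form C)) \<and>
    colon_part F 1 Q = {0})"
proof -
  from assms obtain G where F: "F \<in> forms 3" "smooth_form F"
    and G: "G \<in> cubic_perp (jacobian_part F 3)" "smooth_form G"
    by (auto simp: smooth_perp_cubics_def)
  obtain lam where "socle_functional F lam" using socle_functional_exists[OF F] by blast
  then interpret socle_functional F lam .
  obtain Q1 where Q1: "Q1 \<in> forms 2" "fano_K3_pair F Q1" using exists_fano_K3_pair[OF F] by blast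
  obtain Q2 where Q2: "Q2 \<in> forms 2" "smooth_form (dual_cubic Q2)"
    using cubic_perp_jacobian_part[OF G(1)] G(2) by blast
  obtain \<phi> where \<phi>: "poly_fun \<phi>" "\<phi> Q1 \<noteq> 0" "\<And>Q. Q \<in> forms 2 \<Longrightarrow> \<phi> Q \<noteq> 0 \<Longrightarrow> fano_K3_pair F Q"
    using fano_K3_pair_open[OF F Q1(2)] by blast
  obtain \<psi> where \<psi>: "poly_fun \<psi>" "\<psi> Q2 \<noteq> 0"
    "\<And>Q. Q \<in> forms 2 \<Longrightarrow> \<psi> Q \<noteq> 0 \<Longrightarrow> smooth_form (dual_cubic Q)"
    using smooth_dual_cubic_open[OF Q2] by blast
  \<comment> \<open>The conditions are witnessed by unrelated quadrics \<open>Q1\<close> and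
    \<open>Q2\<close>; the product cuts out the intersection of the two open sets.\<close>
  obtain p where p: "\<And>Q. \<phi> Q * \<psi> Q = mv_eval p (lookup Q)"
    using poly_fun_mult[OF \<phi>(1) \<psi>(1)] unfolding poly_fun_def by blast
  define U where "U = {Q \<in> forms 2. \<exists>p\<in>{p}. mv_eval p (lookup Q) \<noteq> 0}"
  have U: "Q \<in> U \<longleftrightarrow> Q \<in> forms 2 \<and> \<phi> Q \<noteq> 0 \<and> \<psi> Q \<noteq> 0" for Q
    by (auto simp: U_def p[symmetric])
  show ?thesis
    unfolding generic_form_def
  proof (intro exI[of _ U] conjI ballI allI impI)
    show "zariski_open_forms 2 U" unfolding zariski_open_forms_def U_def by blast
    show "U \<noteq> {}"
      using poly_fun_nonzero_common[OF \<phi>(1) \<psi>(1) Q1(1) Q2(1) \<phi>(2) \<psi>(2)] U by blast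
    fix Q assume "Q \<in> U"
    then have Q: "Q \<in> forms 2" "\<phi> Q \<noteq> 0" "\<psi> Q \<noteq> 0" by (simp_all add: U)
    then show "fano_K3_pair F Q" by (intro \<phi>(3))
    have smooth: "smooth_form (dual_cubic Q)" using Q by (intro \<psi>(3))
    show "\<exists>C. associated_cubic F Q C" using associated_cubic_iff[OF Q(1)] by blast
    show "smooth_form C" if "associated_cubic F Q C" for C
      using associated_cubic_smooth[OF Q(1) smooth that] .
    show "colon_part F 1 Q = {0}" by (rule colon_part_1[OF Q(1) smooth])
  qed
qed

end
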